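(* Let $p \geq 2$ be a real number. A $\sigma$-Dedekind complete Banach lattice has the positive $DP^\ast$ property of order $p$ if and only if it has the disjoint Dunford-Pettis* property of order $p$ (disjoint $DP^\ast P_p$).
   Context: A sequence $(x_n)_n$ in a Banach lattice is disjoint if $|x_n| \wedge |x_m| = 0$ whenever $n \neq m$, and positive if $x_n \geq 0$ for every $n$. A sequence $(x_n)_n$ in a Banach space $X$ is weakly $p$-summable if $\sum_n |x^\ast(x_n)|^p < \infty$ for every $x^\ast \in X^\ast$. A subset $A$ of a Banach space $X$ is limited if every weak* null sequence in $X^\ast$ converges uniformly to zero on $A$. A Banach lattice $E$ has the disjoint $DP^\ast P_p$ if, for every disjoint weakly $p$-summable sequence $(x_n)_n$ in $E$, the set $\{x_n : n \in \mathbb{N}\}$ is limited. A bounded subset $A$ of a Banach lattice $E$ is positively limited if every positive weak* null sequence in $E^\ast$ converges uniformly to zero on $A$. A set $A$ is relatively weakly $p$-compact if every sequence in $A$ has a subsequence $(x_{n_j})_j$ such that $(x_{n_j}-x)_j$ is weakly $p$-summable for some $x \in E$. A Banach lattice $E$ has the positive $DP^\ast$ property of order $p$ if every relatively weakly $p$-compact subset of $E$ is positively limited; equivalently, if $x_n^\ast(x_n) \longrightarrow 0$ for every weakly $p$-summable sequence $(x_n)_n$ in $E$ and every positive weak* null sequence $(x_n^\ast)_n$ in $E^\ast$. *)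

theory Defs
  imports "HOL-Analysis.Analysis" "HOL-Library.Lattice_Algebras"
begin

text \<open>Real Banach lattices. Compatibility of the order with the vector space structure comes from
  \<^class>\<open>ordered_real_vector\<close>, and \<^class>\<open>lattice_ab_group_add_abs\<close> fixes the modulus
  as \<open>\<bar>x\<bar> = sup x (- x)\<close>.\<close>

class banach_lattice = banach + ordered_real_vector + lattice_ab_group_add_abs +
  assumes norm_mono_abs: "\<bar>x\<bar> \<le> \<bar>y\<bar> \<Longrightarrow> norm x \<le> norm y"

instance real :: banach_lattice
  by standard simp

definition sigma_dedekind_complete :: "'a::order itself \<Rightarrow> bool" where
  "sigma_dedekind_complete _ \<longleftrightarrow>
     (\<forall>A::'a set. countable A \<and> A \<noteq> {} \<and> bdd_above A \<longrightarrow>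
        (\<exists>s. (\<forall>a\<in>A. a \<le> s) \<and> (\<forall>b. (\<forall>a\<in>A. a \<le> b) \<longrightarrow> s \<le> b)))"

definition disjoint_seq :: "(nat \<Rightarrow> 'a::banach_lattice) \<Rightarrow> bool" where
  "disjoint_seq x \<longleftrightarrow> (\<forall>n m. n \<noteq> m \<longrightarrow> inf \<bar>x n\<bar> \<bar>x m\<bar> = 0)"

definition weakly_p_summable :: "real \<Rightarrow> (nat \<Rightarrow> 'a::banach) \<Rightarrow> bool" where
  "weakly_p_summable p x \<longleftrightarrow>
     (\<forall>f :: 'a \<Rightarrow>\<^sub>L real. summable (\<lambda>n. \<bar>blinfun_apply f (x n)\<bar> powr p))"

definition weak_star_null :: "(nat \<Rightarrow> 'a::banach \<Rightarrow>\<^sub>L real) \<Rightarrow> bool" where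
  "weak_star_null f \<longleftrightarrow> (\<forall>x. (\<lambda>n. blinfun_apply (f n) x) \<longlonglongrightarrow> 0)"

text \<open>The order of the dual Banach lattice enters only through its positive cone.\<close>

definition positive_functional :: "('a::banach_lattice \<Rightarrow>\<^sub>L real) \<Rightarrow> bool" where
  "positive_functional f \<longleftrightarrow> (\<forall>x\<ge>0. 0 \<le> blinfun_apply f x)"

definition limited_set :: "'a::banach set \<Rightarrow> bool" where
  "limited_set A \<longleftrightarrow>
     (\<forall>f. weak_star_null f \<longrightarrow>
        uniform_limit A (\<lambda>n x. blinfun_apply (f n) x) (\<lambda>x. 0) sequentially)"

definition positively_limited_set :: "'a::banach_lattice set \<Rightarrow> bool" where
  "positively_limited_set A \<longleftrightarrow> bounded A \<and>
     (\<forall>f. weak_star_null f \<and> (\<forall>n. positive_functional (f n)) \<longrightarrow>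
        uniform_limit A (\<lambda>n x. blinfun_apply (f n) x) (\<lambda>x. 0) sequentially)"

definition relatively_weakly_p_compact :: "real \<Rightarrow> 'a::banach set \<Rightarrow> bool" where
  "relatively_weakly_p_compact p A \<longleftrightarrow>
     (\<forall>x. (\<forall>n. x n \<in> A) \<longrightarrow>
        (\<exists>r l. strict_mono (r :: nat \<Rightarrow> nat) \<and> weakly_p_summable p (\<lambda>j. x (r j) - l)))"

definition disjoint_DP_star :: "'a::banach_lattice itself \<Rightarrow> real \<Rightarrow> bool" where
  "disjoint_DP_star _ p \<longleftrightarrow>
     (\<forall>x :: nat \<Rightarrow> 'a. disjoint_seq x \<and> weakly_p_summable p x \<longrightarrow> limited_set (range x))"

definition positive_DP_star :: "'a::banach_lattice itself \<Rightarrow> real \<Rightarrow> bool" where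
  "positive_DP_star _ p \<longleftrightarrow>
     (\<forall>A :: 'a set. relatively_weakly_p_compact p A \<longrightarrow> positively_limited_set A)"

end

theory Submission
  imports Defs
begin

text \<open>Both properties say that certain functionals tend to zero along weakly \<open>p\<close>-summable sequences.
  The positive property allows all such sequences but only positive functionals; the disjoint
  property allows all functionals but only disjoint sequences.  The bridge is the observation that a
  disjoint positive sequence \<open>y\<close> with \<open>y k \<le> \<bar>x k\<bar>\<close> is weakly \<open>p\<close>-summable
  whenever \<open>x\<close> is (\<open>weakly_p_summable_disjoint_minorant\<close>): by averaging over signs,
  \<open>\<bar>a j x j\<bar>\<close> lies below the mean of \<open>\<bar>\<Sum> \<plusminus> a k x k\<bar>\<close>, and for disjoint
  \<open>y\<close> the sum of the \<open>a k y k\<close> is their supremum.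

  Suppose the disjoint property holds.  If a positive weak* null sequence \<open>F\<close> stays away from
  zero along a weakly \<open>p\<close>-summable sequence \<open>w\<close>, it also stays away from zero along
  \<open>\<bar>w k\<bar>\<close>.  The disjointification argument (\<open>disjoint_minorants_exist\<close>) extracts
  disjoint minorants on which a subsequence of \<open>F\<close> is still large.  They are weakly
  \<open>p\<close>-summable, so their set is limited, a contradiction.  Boundedness of relatively weakly
  \<open>p\<close>-compact sets follows from uniform boundedness and the existence of norming functionals.

  Suppose the positive property holds, and let \<open>f\<close> be weak* null and \<open>x\<close> disjoint and weakly
  \<open>p\<close>-summable.  The positive and negative parts of \<open>x\<close> are disjoint minorants, so \<open>x\<close> may be
  replaced by a positive disjoint sequence \<open>u\<close>.  The component \<open>g n\<close> of \<open>(f n)\<^sup>+\<close> on the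
  band generated by \<open>u n\<close> satisfies \<open>f n (u n) \<le> g n (u n)\<close>, and \<open>g\<close> is weak* null
  (\<open>positive_weak_star_null_majorant\<close>); the positive property then gives
  \<open>g n (u n) \<longlonglongrightarrow> 0\<close>.  That \<open>g\<close> is weak* null amounts to
  \<open>f n (z n) \<longlonglongrightarrow> 0\<close> for order bounded disjoint sequences \<open>z\<close>
  (\<open>order_bounded_disjoint_null\<close>).  There \<open>\<sigma>\<close>-Dedekind completeness enters: it
  provides the suprema of all subfamilies of \<open>z\<close>, and a gliding hump in the form of Rosenthal's
  lemma applies to them, as in Phillips' lemma.\<close>

section \<open>Moduli, norms and disjointness in Banach lattices\<close>
lemma pprt_diff:
  fixes x :: "'a::lattice_ab_group_add"
  shows "pprt x - pprt (- x) = x"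
  unfolding pprt_neg diff_minus_eq_add by (rule prts[symmetric])

lemma scaleR_sup_distrib:
  fixes x y :: "'a::banach_lattice"
  assumes "c \<ge> 0"
  shows "c *\<^sub>R sup x y = sup (c *\<^sub>R x) (c *\<^sub>R y)"
proof (cases "c = 0")
  case False
  with assms have c: "c > 0" by simp
  show ?thesis
  proof (rule antisym)
    have "sup x y \<le> inverse c *\<^sub>R sup (c *\<^sub>R x) (c *\<^sub>R y)"
    proof (rule sup_least)
      have "inverse c *\<^sub>R (c *\<^sub>R x) \<le> inverse c *\<^sub>R sup (c *\<^sub>R x) (c *\<^sub>R y)"
        using c by (intro scaleR_left_mono) auto
      then show "x \<le> inverse c *\<^sub>R sup (c *\<^sub>R x) (c *\<^sub>R y)" using c by simp
      have "inverse c *\<^sub>R (c *\<^sub>R y) \<le> inverse c *\<^sub>R sup (c *\<^sub>R x) (c *\<^sub>R y)"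
        using c by (intro scaleR_left_mono) auto
      then show "y \<le> inverse c *\<^sub>R sup (c *\<^sub>R x) (c *\<^sub>R y)" using c by simp
    qed
    from scaleR_left_mono[OF this, of c]
    show "c *\<^sub>R sup x y \<le> sup (c *\<^sub>R x) (c *\<^sub>R y)" using c by simp
  qed (use assms in \<open>auto intro!: scaleR_left_mono\<close>)
qed simp

lemma scaleR_inf_distrib:
  fixes x y :: "'a::banach_lattice"
  assumes "c \<ge> 0"
  shows "c *\<^sub>R inf x y = inf (c *\<^sub>R x) (c *\<^sub>R y)"
proof -
  have "inf x y = - sup (- x) (- y)" by (rule inf_eq_neg_sup)
  moreover have "inf (c *\<^sub>R x) (c *\<^sub>R y) = - sup (c *\<^sub>R (- x)) (c *\<^sub>R (- y))"
    unfolding scaleR_minus_right by (rule inf_eq_neg_sup)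
  ultimately show ?thesis
    by (simp only: scaleR_minus_right[of c "sup _ _"] scaleR_sup_distrib[OF assms])
qed

lemma pprt_scaleR:
  fixes x :: "'a::banach_lattice"
  shows "c \<ge> 0 \<Longrightarrow> pprt (c *\<^sub>R x) = c *\<^sub>R pprt x"
  by (simp add: pprt_def scaleR_sup_distrib)

lemma abs_scaleR:
  fixes x :: "'a::banach_lattice"
  shows "\<bar>c *\<^sub>R x\<bar> = \<bar>c\<bar> *\<^sub>R \<bar>x\<bar>"
proof (cases "c \<ge> 0")
  case True
  have "pprt (- (c *\<^sub>R x)) = c *\<^sub>R pprt (- x)" using pprt_scaleR[OF True, of "-x"] by simp
  then show ?thesis using True pprt_scaleR[OF True, of x]
    by (simp add: abs_prts pprt_neg scaleR_diff_right)
next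
  case False
  then have c: "- c \<ge> 0" by simp
  have "\<bar>c *\<^sub>R x\<bar> = \<bar>(- c) *\<^sub>R x\<bar>" by simp
  also have "\<dots> = (- c) *\<^sub>R \<bar>x\<bar>"
    using pprt_scaleR[OF c, of x] pprt_scaleR[OF c, of "-x"]
    by (simp add: abs_prts pprt_neg scaleR_diff_right nprt_neg)
  finally show ?thesis using False by simp
qed

lemma norm_mono_pos:
  fixes x y :: "'a::banach_lattice"
  assumes "0 \<le> x" "x \<le> y"
  shows "norm x \<le> norm y"
proof -
  have "0 \<le> y" using assms by (rule order_trans)
  then show ?thesis using assms by (intro norm_mono_abs) simp
qed

lemma pprt_le_abs: "pprt x \<le> \<bar>x :: 'a::lattice_ab_group_add_abs\<bar>"
  by (simp add: abs_prts)

lemma pprt_uminus_le_abs: "pprt (- x) \<le> \<bar>x :: 'a::lattice_ab_group_add_abs\<bar>"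
  by (simp add: abs_prts pprt_neg)

lemma norm_pprt_le: "norm (pprt x) \<le> norm (x :: 'a::banach_lattice)"
  using pprt_le_abs[of x] by (intro norm_mono_abs) simp

lemma abs_eq_pprt_sum: "\<bar>x\<bar> = pprt x + pprt (- x :: 'a::lattice_ab_group_add_abs)"
  by (simp add: abs_prts pprt_neg)

text \<open>The positive cone is closed: the negative part of the limit is dominated by the distance to
  every positive term.\<close>
lemma nonneg_of_LIMSEQ:
  fixes s :: "nat \<Rightarrow> 'a::banach_lattice"
  assumes lim: "s \<longlonglongrightarrow> l" and ev: "eventually (\<lambda>n. 0 \<le> s n) sequentially"
  shows "0 \<le> l"
proof -
  have "eventually (\<lambda>n. norm (pprt (- l)) \<le> norm (s n - l)) sequentially"
    using ev
  proof eventually_elim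
    case (elim n)
    have "- l \<le> s n - l" using elim by simp
    also have "\<dots> \<le> \<bar>s n - l\<bar>" by (rule abs_ge_self)
    finally have "pprt (- l) \<le> \<bar>s n - l\<bar>" by (simp add: pprt_def)
    then show ?case by (intro norm_mono_abs) simp
  qed
  moreover have "(\<lambda>n. norm (s n - l)) \<longlonglongrightarrow> 0"
    using lim by (simp add: LIM_zero tendsto_norm_zero)
  ultimately have "norm (pprt (- l)) \<le> 0"
    by (intro tendsto_lowerbound[of _ 0 sequentially]) auto
  then have "pprt (- l) = 0" by simp
  then show ?thesis by (metis le_zero_iff_zero_pprt neg_le_0_iff_le)
qed

lemma suminf_term_le:
  fixes s :: "nat \<Rightarrow> 'a::banach_lattice"
  assumes "summable s" "\<And>n. 0 \<le> s n"
  shows "s k \<le> suminf s"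
proof -
  have "(\<lambda>n. sum s {..<n} - s k) \<longlonglongrightarrow> suminf s - s k"
    using assms(1) by (intro tendsto_intros summable_LIMSEQ)
  moreover have "eventually (\<lambda>n. 0 \<le> sum s {..<n} - s k) sequentially"
    using eventually_gt_at_top[of k]
  proof eventually_elim
    case (elim n)
    then have "sum s {..<n} = s k + sum s ({..<n} - {k})" by (intro sum.remove) auto
    then show ?case using assms(2) by (simp add: sum_nonneg)
  qed
  ultimately have "0 \<le> suminf s - s k" by (rule nonneg_of_LIMSEQ)
  then show ?thesis by simp
qed

lemma inf_eq_0_mono:
  fixes x y :: "'a::lattice_ab_group_add"
  assumes "inf x y = 0" "0 \<le> x'" "x' \<le> x" "0 \<le> y'" "y' \<le> y"
  shows "inf x' y' = 0"
proof (rule antisym)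
  show "inf x' y' \<le> 0" using inf_mono[OF assms(3,5)] assms(1) by simp
  show "0 \<le> inf x' y'" using assms(2,4) by (rule inf_greatest)
qed

text \<open>Subtracting \<open>inf x v\<close> from \<open>inf (x + y) v\<close> leaves an element below both
  \<open>y\<close> and \<open>v\<close>.  Hence the elements disjoint from a fixed set are closed under addition.\<close>
lemma inf_add_le:
  fixes x y v :: "'a::lattice_ab_group_add"
  assumes "0 \<le> x" "0 \<le> y" "0 \<le> v"
  shows "inf (x + y) v \<le> inf x v + inf y v"
proof -
  let ?z = "inf (x + y) v"
  have "?z - inf x v \<le> inf y v"
  proof -
    have eq: "?z - inf x v = sup (?z - x) (?z - v)"
      by (simp add: diff_inf_eq_sup add_sup_distrib_left)
    have "?z - x \<le> y" by (simp add: diff_le_eq add.commute)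
    moreover have "?z - x \<le> v" using assms(1) by (simp add: diff_le_eq add_increasing2 le_infI2)
    moreover have "?z - v \<le> 0" by simp
    ultimately show ?thesis
      unfolding eq using assms(2,3) by (meson order_trans le_infI le_supI)
  qed
  then show ?thesis by (metis add.commute diff_le_eq)
qed

lemma inf_add_eq_0:
  fixes x y v :: "'a::lattice_ab_group_add"
  assumes "0 \<le> x" "0 \<le> y" "0 \<le> v" "inf x v = 0" "inf y v = 0"
  shows "inf (x + y) v = 0"
proof (rule antisym)
  show "inf (x + y) v \<le> 0" using inf_add_le[OF assms(1-3)] assms(4,5) by simp
  show "0 \<le> inf (x + y) v" using assms(1-3) by (intro inf_greatest add_nonneg_nonneg)
qed

lemma inf_scaleR_eq_0:
  fixes x v :: "'a::banach_lattice"
  assumes "0 \<le> x" "0 \<le> v" "inf x v = 0" "0 \<le> c"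
  shows "inf (c *\<^sub>R x) v = 0"
proof (rule inf_eq_0_mono)
  \<comment> \<open>Both factors are scaled by a common constant, which pulls out of the infimum.\<close>
  let ?C = "max 1 c"
  show "inf (?C *\<^sub>R x) (?C *\<^sub>R v) = 0"
    using scaleR_inf_distrib[of ?C x v] assms(3) by simp
  show "c *\<^sub>R x \<le> ?C *\<^sub>R x" using assms by (intro scaleR_right_mono) auto
  show "v \<le> ?C *\<^sub>R v" using scaleR_right_mono[of 1 ?C v] assms by simp
  show "0 \<le> c *\<^sub>R x" using assms by (intro scaleR_nonneg_nonneg)
  show "0 \<le> v" by (rule assms(2))
qed

lemma inf_pprt_uminus_eq_0:
  fixes x :: "'a::lattice_ab_group_add"
  shows "inf (pprt x) (pprt (- x)) = 0"
proof -
  have "inf (pprt x) (pprt (- x)) = pprt (- x) + inf (pprt x - pprt (- x)) 0"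
    by (subst add_inf_distrib_left) simp
  also have "\<dots> = pprt (- x) + nprt x" by (simp add: pprt_diff nprt_def)
  finally show ?thesis by (simp add: pprt_neg)
qed

text \<open>For disjoint elements sum and supremum coincide.\<close>
lemma disjoint_sum_le:
  fixes y :: "nat \<Rightarrow> 'a::lattice_ab_group_add"
  assumes "finite A" "\<And>k. 0 \<le> y k" "\<And>j k. j \<noteq> k \<Longrightarrow> inf (y j) (y k) = 0"
    "\<And>k. k \<in> A \<Longrightarrow> y k \<le> w" "0 \<le> w"
  shows "sum y A \<le> w"
proof -
  have "(\<forall>k\<in>A. y k \<le> w) \<longrightarrow> sum y A \<le> w \<and> (\<forall>j. j \<notin> A \<longrightarrow> inf (sum y A) (y j) = 0)"
    using assms(1)
  proof (induction A)
    case empty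
    then show ?case using assms(2,5) by (simp add: inf_absorb1)
  next
    case (insert k A)
    show ?case
    proof (intro impI)
      assume le: "\<forall>k\<in>insert k A. y k \<le> w"
      then have IH: "sum y A \<le> w" and disj: "\<And>j. j \<notin> A \<Longrightarrow> inf (sum y A) (y j) = 0"
        using insert.IH by blast+
      have "sum y A + y k = sup (sum y A) (y k)"
        using add_eq_inf_sup[of "sum y A" "y k"] disj[OF insert.hyps(2)] by simp
      then have "sum y (insert k A) = sup (sum y A) (y k)"
        using insert.hyps by (simp add: add.commute)
      then have "sum y (insert k A) \<le> w" using IH le by simp
      moreover have "inf (sum y (insert k A)) (y j) = 0" if "j \<notin> insert k A" for j
      proof -
        have "inf (y k + sum y A) (y j) = 0"
          using that assms(2) by (intro inf_add_eq_0 sum_nonneg assms(3) disj) auto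
        then show ?thesis using insert.hyps by simp
      qed
      ultimately show "sum y (insert k A) \<le> w \<and>
          (\<forall>j. j \<notin> insert k A \<longrightarrow> inf (sum y (insert k A)) (y j) = 0)" by blast
    qed
  qed
  then show ?thesis using assms(4) by blast
qed

section \<open>Components of functionals\<close>

text \<open>The functionals below are given by suprema that make sense on the positive cone; writing every vector as
  a difference of positive ones extends them, with a factor \<open>2\<close> in the norm.\<close>
lemma cone_functional_extends:
  fixes T :: "'a::banach_lattice \<Rightarrow> real"
  assumes add: "\<And>x y. 0 \<le> x \<Longrightarrow> 0 \<le> y \<Longrightarrow> T (x + y) = T x + T y"
    and scale: "\<And>c x. 0 \<le> c \<Longrightarrow> 0 \<le> x \<Longrightarrow> T (c *\<^sub>R x) = c * T x"
    and bnd: "\<And>x. 0 \<le> x \<Longrightarrow> \<bar>T x\<bar> \<le> K * norm x"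
    and K: "0 \<le> K"
  shows "\<exists>F. (\<forall>x\<ge>0. blinfun_apply F x = T x) \<and> norm F \<le> 2 * K"
proof -
  define F where "F x = T (pprt x) - T (pprt (- x))" for x
  have F_diff: "F (u - v) = T u - T v" if "0 \<le> u" "0 \<le> v" for u v
  proof -
    have "pprt (u - v) + v = pprt (- (u - v)) + u"
      using pprt_diff[of "u - v"] by (simp add: algebra_simps)
    then have "T (pprt (u - v)) + T v = T (pprt (- (u - v))) + T u"
      using add that by (metis zero_le_pprt)
    then show ?thesis by (simp add: F_def)
  qed
  have F_add: "F (x + y) = F x + F y" for x y
  proof -
    have "x + y = (pprt x + pprt y) - (pprt (- x) + pprt (- y))"
      using pprt_diff[of x] pprt_diff[of y] by (metis add_diff_add)
    then have "F (x + y) = T (pprt x + pprt y) - T (pprt (- x) + pprt (- y))"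
      by (metis F_diff add_nonneg_nonneg zero_le_pprt)
    then show ?thesis by (simp add: add F_def)
  qed
  have F_pos: "F (c *\<^sub>R x) = c * F x" if "c \<ge> 0" for c x
    using that pprt_scaleR[OF that, of "- x"] by (simp add: F_def pprt_scaleR scale right_diff_distrib)
  have F_neg: "F (- x) = - F x" for x by (simp add: F_def)
  have F_scale: "F (c *\<^sub>R x) = c * F x" for c x
  proof (cases "c \<ge> 0")
    case False
    then have "F (c *\<^sub>R x) = - F ((- c) *\<^sub>R x)" by (simp add: F_neg)
    then show ?thesis using False F_pos[of "-c" x] by simp
  qed (rule F_pos)
  have F_bnd: "norm (F x) \<le> 2 * K * norm x" for x
  proof -
    have "norm (F x) \<le> \<bar>T (pprt x)\<bar> + \<bar>T (pprt (- x))\<bar>" by (simp add: F_def)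
    also have "\<dots> \<le> K * norm (pprt x) + K * norm (pprt (- x))"
      by (intro add_mono bnd) simp_all
    also have "\<dots> \<le> K * norm x + K * norm (- x)"
      using K by (intro add_mono mult_left_mono norm_pprt_le)
    finally show ?thesis by simp
  qed
  have lin: "bounded_linear F"
    by (rule bounded_linear_intro[where K = "2 * K"]) (use F_add F_scale F_bnd in \<open>auto simp: mult.commute\<close>)
  have "T 0 = 0" using add[of 0 0] by simp
  then have "blinfun_apply (Blinfun F) x = T x" if "x \<ge> 0" for x
    using that by (simp add: bounded_linear_Blinfun_apply[OF lin] F_def)
  moreover have "norm (Blinfun F) \<le> 2 * K"
    using K F_bnd by (intro norm_blinfun_bound) (auto simp: bounded_linear_Blinfun_apply[OF lin])
  ultimately show ?thesis by blast
qed

definition orthogonal_interval :: "'a::banach_lattice set \<Rightarrow> 'a \<Rightarrow> 'a set" where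
  "orthogonal_interval D y = {z. 0 \<le> z \<and> z \<le> y \<and> (\<forall>v\<in>D. inf z v = 0)}"

text \<open>The Riesz decomposition property survives the restriction to a disjoint complement, because
  both pieces lie below \<open>z\<close>.\<close>
lemma orthogonal_interval_decompose:
  assumes D: "\<forall>v\<in>D. 0 \<le> v" and "0 \<le> x" "0 \<le> y" and z: "z \<in> orthogonal_interval D (x + y)"
  obtains a b where "a \<in> orthogonal_interval D x" "b \<in> orthogonal_interval D y" "z = a + b"
proof
  have "z - inf z x = sup 0 (z - x)" by (simp add: diff_inf_eq_sup add_sup_distrib_left)
  then have *: "0 \<le> z - inf z x" "z - inf z x \<le> y" "z - inf z x \<le> z"
    using z assms by (auto simp: orthogonal_interval_def diff_le_eq add.commute)
  show "inf z x \<in> orthogonal_interval D x" "z - inf z x \<in> orthogonal_interval D y"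
    using z D assms(2) * by (auto simp: orthogonal_interval_def intro: inf_eq_0_mono[of z])
  show "z = inf z x + (z - inf z x)" by (metis add.commute diff_add_cancel)
qed

lemma orthogonal_interval_add:
  assumes "\<forall>v\<in>D. 0 \<le> v" and "a \<in> orthogonal_interval D x" "b \<in> orthogonal_interval D y"
  shows "a + b \<in> orthogonal_interval D (x + y)"
proof -
  have ab: "0 \<le> a" "a \<le> x" "\<forall>v\<in>D. inf a v = 0" "0 \<le> b" "b \<le> y" "\<forall>v\<in>D. inf b v = 0"
    using assms(2,3) by (simp_all add: orthogonal_interval_def)
  then have "\<forall>v\<in>D. inf (a + b) v = 0" using assms(1) inf_add_eq_0 by blast
  then show ?thesis using ab by (simp add: orthogonal_interval_def add_mono)
qed

lemma orthogonal_interval_scaleR: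
  assumes "\<forall>v\<in>D. 0 \<le> v" and "0 \<le> c" "a \<in> orthogonal_interval D x"
  shows "c *\<^sub>R a \<in> orthogonal_interval D (c *\<^sub>R x)"
proof -
  have a: "0 \<le> a" "a \<le> x" "\<forall>v\<in>D. inf a v = 0"
    using assms(3) by (simp_all add: orthogonal_interval_def)
  then have "\<forall>v\<in>D. inf (c *\<^sub>R a) v = 0" using assms(1,2) inf_scaleR_eq_0 by blast
  then show ?thesis
    using a assms(2) by (simp add: orthogonal_interval_def scaleR_left_mono scaleR_nonneg_nonneg)
qed

text \<open>The Riesz--Kantorovich formula for the positive part of \<open>f\<close>, localised: the functional
  \<open>g y = sup {f z | z \<in> orthogonal_interval D y}\<close> is the component of \<open>f\<^sup>+\<close>
  that lives on the disjoint complement of \<open>D\<close>.  Additivity is the decomposition property.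
  The construction replaces band projections of the lattice, so it works in every Banach lattice.\<close>
lemma disjoint_component_functional:
  fixes f :: "'a::banach_lattice \<Rightarrow>\<^sub>L real"
  assumes D: "\<forall>v\<in>D. 0 \<le> v"
  shows "\<exists>g. positive_functional g \<and> norm g \<le> 2 * norm f
    \<and> (\<forall>y. \<forall>z\<in>orthogonal_interval D y. blinfun_apply f z \<le> blinfun_apply g y)
    \<and> (\<forall>y\<ge>0. \<forall>e>0. \<exists>z\<in>orthogonal_interval D y. blinfun_apply g y < blinfun_apply f z + e)"
proof -
  define T where "T y = (SUP z\<in>orthogonal_interval D y. blinfun_apply f z)" for y
  have bound: "blinfun_apply f z \<le> norm f * norm y" if "z \<in> orthogonal_interval D y" for y z
  proof -
    have "norm z \<le> norm y" using that by (intro norm_mono_pos) (auto simp: orthogonal_interval_def)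
    then have "norm f * norm z \<le> norm f * norm y" by (intro mult_left_mono) auto
    then show ?thesis using norm_blinfun[of f z] by simp
  qed
  have zero: "0 \<in> orthogonal_interval D y" if "0 \<le> y" for y
    using that D by (auto simp: orthogonal_interval_def inf_absorb1)
  have bdd: "bdd_above (blinfun_apply f ` orthogonal_interval D y)" for y
    using bound by (auto intro!: bdd_aboveI2)
  have upper: "blinfun_apply f z \<le> T y" if "z \<in> orthogonal_interval D y" for y z
    unfolding T_def using that by (intro cSUP_upper bdd)
  have approx: "\<exists>z\<in>orthogonal_interval D y. T y < blinfun_apply f z + e" if y: "0 \<le> y" and e: "0 < e" for y e
  proof -
    have "T y - e < T y" using e by simp
    then obtain z where "z \<in> orthogonal_interval D y" "T y - e < blinfun_apply f z"
      unfolding T_def using less_cSUP_iff[OF _ bdd] zero[OF y]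
      by (metis (no_types, lifting) empty_iff)
    then show ?thesis by (intro bexI[of _ z]) auto
  qed
  have least: "T y \<le> B" if "0 \<le> y" "\<And>z. z \<in> orthogonal_interval D y \<Longrightarrow> blinfun_apply f z \<le> B" for y B
    unfolding T_def using that zero by (intro cSUP_least) auto
  have T_nonneg: "0 \<le> T y" if "0 \<le> y" for y
    using upper[OF zero[OF that]] by (simp add: blinfun.zero_right)
  have T_add: "T (x + y) = T x + T y" if xy: "0 \<le> x" "0 \<le> y" for x y
  proof (rule antisym)
    show "T (x + y) \<le> T x + T y"
    proof (rule least)
      fix z assume "z \<in> orthogonal_interval D (x + y)"
      then obtain a b where "a \<in> orthogonal_interval D x" "b \<in> orthogonal_interval D y" "z = a + b"
        using orthogonal_interval_decompose[OF D xy] by blast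
      then show "blinfun_apply f z \<le> T x + T y"
        using upper by (simp add: blinfun.add_right add_mono)
    qed (use xy in simp)
    show "T x + T y \<le> T (x + y)"
    proof (rule field_le_epsilon)
      fix e :: real assume "0 < e"
      then obtain a b where ab: "a \<in> orthogonal_interval D x" "T x < blinfun_apply f a + e / 2"
        "b \<in> orthogonal_interval D y" "T y < blinfun_apply f b + e / 2"
        using approx[OF xy(1), of "e/2"] approx[OF xy(2), of "e/2"] by auto
      have "blinfun_apply f (a + b) \<le> T (x + y)"
        using ab orthogonal_interval_add[OF D] by (intro upper) auto
      then show "T x + T y \<le> T (x + y) + e" using ab by (simp add: blinfun.add_right)
    qed
  qed
  have T_scale_le: "c * T x \<le> T (c *\<^sub>R x)" if cx: "0 \<le> c" "0 \<le> x" for c x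
  proof (cases "c = 0")
    case True
    then show ?thesis using T_nonneg[of 0] by simp
  next
    case False
    then have c: "c > 0" using cx by simp
    have "T x \<le> T (c *\<^sub>R x) / c"
    proof (rule least[OF cx(2)])
      fix z assume "z \<in> orthogonal_interval D x"
      then have "blinfun_apply f (c *\<^sub>R z) \<le> T (c *\<^sub>R x)"
        using orthogonal_interval_scaleR[OF D] cx by (intro upper) auto
      then show "blinfun_apply f z \<le> T (c *\<^sub>R x) / c"
        using c by (simp add: blinfun.scaleR_right field_simps)
    qed
    then show ?thesis using c by (simp add: field_simps)
  qed
  have T_scale: "T (c *\<^sub>R x) = c * T x" if cx: "0 \<le> c" "0 \<le> x" for c x
  proof (cases "c = 0")
    case True
    then show ?thesis using T_add[of 0 0] by simp
  next
    case False
    then have "inverse c * T (c *\<^sub>R x) \<le> T x"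
      using T_scale_le[of "inverse c" "c *\<^sub>R x"] cx by (simp add: scaleR_nonneg_nonneg)
    then show ?thesis using False cx T_scale_le[OF cx] by (simp add: field_simps)
  qed
  have "\<bar>T x\<bar> \<le> norm f * norm x" if "0 \<le> x" for x
    using T_nonneg[OF that] least[OF that bound] by simp
  then obtain g where g: "\<forall>x\<ge>0. blinfun_apply g x = T x" "norm g \<le> 2 * norm f"
    using cone_functional_extends[of T "norm f"] T_add T_scale by auto
  show ?thesis
  proof (intro exI[of _ g] conjI allI ballI impI)
    show "positive_functional g" using g T_nonneg by (simp add: positive_functional_def)
    show "norm g \<le> 2 * norm f" by (rule g)
    show "blinfun_apply f z \<le> blinfun_apply g y" if z: "z \<in> orthogonal_interval D y" for y z
    proof -
      have "0 \<le> y" using z by (auto simp: orthogonal_interval_def)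
      then show ?thesis using upper[OF z] g by simp
    qed
    show "\<exists>z\<in>orthogonal_interval D y. blinfun_apply g y < blinfun_apply f z + e" if "0 \<le> y" "0 < e" for y e
      using approx[OF that] g that by simp
  qed
qed

lemma positive_functional_mono:
  "positive_functional f \<Longrightarrow> x \<le> y \<Longrightarrow> blinfun_apply f x \<le> blinfun_apply f y"
  by (metis blinfun.diff_right diff_ge_0_iff_ge positive_functional_def)

text \<open>With \<open>g = f\<^sup>+\<close>, obtained by taking \<open>D\<close> empty, the functional \<open>2 g - f\<close>
  is the modulus of \<open>f\<close>.\<close>
lemma positive_majorant:
  fixes f :: "'a::banach_lattice \<Rightarrow>\<^sub>L real"
  obtains h where "positive_functional h" "norm h \<le> 5 * norm f"
    "\<And>y. 0 \<le> y \<Longrightarrow> \<bar>blinfun_apply f y\<bar> \<le> blinfun_apply h y"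
proof -
  obtain g where g: "positive_functional g" "norm g \<le> 2 * norm f"
    "\<And>y z. z \<in> orthogonal_interval {} y \<Longrightarrow> blinfun_apply f z \<le> blinfun_apply g y"
    using disjoint_component_functional[of "{}" f] by blast
  have fg: "blinfun_apply f y \<le> blinfun_apply g y" if "0 \<le> y" for y
    using that by (intro g) (simp add: orthogonal_interval_def)
  have g0: "0 \<le> blinfun_apply g y" if "0 \<le> y" for y
    using that g(1) by (simp add: positive_functional_def)
  have *: "\<bar>blinfun_apply f y\<bar> \<le> blinfun_apply (2 *\<^sub>R g - f) y" if "0 \<le> y" for y
    using fg[OF that] g0[OF that] by (simp add: blinfun.diff_left blinfun.scaleR_left abs_le_iff)
  show ?thesis
  proof
    show "positive_functional (2 *\<^sub>R g - f)"
      using * by (force simp: positive_functional_def)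
    have "norm (2 *\<^sub>R g - f) \<le> norm (2 *\<^sub>R g) + norm f" by (rule norm_triangle_ineq4)
    then show "norm (2 *\<^sub>R g - f) \<le> 5 * norm f" using g(2) by simp
  qed (rule *)
qed

text \<open>Let \<open>k\<close> be the component of \<open>h\<close> on the disjoint complement of the negative part
  of \<open>v\<close>.  It agrees with \<open>h\<close> on the positive part of \<open>v\<close> and vanishes on the
  negative part, so \<open>2 k - h\<close> takes the value \<open>h \<bar>v\<bar>\<close> at \<open>v\<close>.
  This turns estimates for \<open>h \<bar>v\<bar>\<close> into estimates for functionals at \<open>v\<close>.\<close>
lemma functional_attaining_modulus:
  fixes h :: "'a::banach_lattice \<Rightarrow>\<^sub>L real"
  assumes h: "positive_functional h"
  obtains g where "norm g \<le> 5 * norm h" "blinfun_apply h \<bar>v\<bar> = blinfun_apply g v"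
proof -
  obtain k where k: "norm k \<le> 2 * norm h"
    "\<And>y z. z \<in> orthogonal_interval {pprt (- v)} y \<Longrightarrow> blinfun_apply h z \<le> blinfun_apply k y"
    "\<And>y e. 0 \<le> y \<Longrightarrow> 0 < e \<Longrightarrow> \<exists>z\<in>orthogonal_interval {pprt (- v)} y. blinfun_apply k y < blinfun_apply h z + e"
    using disjoint_component_functional[of "{pprt (- v)}" h] zero_le_pprt by blast
  have le: "blinfun_apply k y \<le> blinfun_apply h w"
    if "0 \<le> y" "\<And>z. z \<in> orthogonal_interval {pprt (- v)} y \<Longrightarrow> z \<le> w" for y w
  proof (rule field_le_epsilon)
    fix e :: real assume "0 < e"
    then obtain z where z: "z \<in> orthogonal_interval {pprt (- v)} y" "blinfun_apply k y < blinfun_apply h z + e"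
      using k(3) \<open>0 \<le> y\<close> by blast
    then have "blinfun_apply h z \<le> blinfun_apply h w" by (intro positive_functional_mono h that)
    then show "blinfun_apply k y \<le> blinfun_apply h w + e" using z by simp
  qed
  have "pprt v \<in> orthogonal_interval {pprt (- v)} (pprt v)"
    by (simp add: orthogonal_interval_def inf_pprt_uminus_eq_0)
  then have 1: "blinfun_apply k (pprt v) = blinfun_apply h (pprt v)"
    by (intro antisym le k) (auto simp: orthogonal_interval_def)
  have "blinfun_apply k (pprt (- v)) \<le> blinfun_apply h 0"
    by (intro le) (auto simp: orthogonal_interval_def inf_absorb1)
  moreover have "blinfun_apply h 0 \<le> blinfun_apply k (pprt (- v))"
    by (intro k) (auto simp: orthogonal_interval_def inf_absorb1)
  ultimately have 2: "blinfun_apply k (pprt (- v)) = 0" by (simp add: blinfun.zero_right)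
  have kv: "blinfun_apply k v = blinfun_apply h (pprt v)"
    by (subst pprt_diff[symmetric]) (simp add: blinfun.diff_right 1 2)
  have hv: "blinfun_apply h v = blinfun_apply h (pprt v) - blinfun_apply h (pprt (- v))"
    by (subst pprt_diff[symmetric]) (simp add: blinfun.diff_right)
  show ?thesis
  proof
    have "norm (2 *\<^sub>R k - h) \<le> norm (2 *\<^sub>R k) + norm h" by (rule norm_triangle_ineq4)
    then show "norm (2 *\<^sub>R k - h) \<le> 5 * norm h" using k(1) by simp
    show "blinfun_apply h \<bar>v\<bar> = blinfun_apply (2 *\<^sub>R k - h) v"
      by (simp add: abs_eq_pprt_sum blinfun.add_right blinfun.diff_left blinfun.scaleR_left kv hv)
  qed
qed

section \<open>Uniform boundedness\<close>

text \<open>A version of the Banach--Steinhaus theorem that covers norms of functionals as well as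
  \<open>p\<close>-th power sums: the only algebraic property of seminorms that the category argument
  needs is an estimate at \<open>(a - b) / 2\<close>, which moves a ball on which the family is bounded to
  the origin.\<close>
lemma uniform_boundedness:
  fixes q :: "nat \<Rightarrow> 'a::banach \<Rightarrow> real"
  assumes cont: "\<And>n. continuous_on UNIV (q n)"
    and half: "\<And>n a b. q n ((1/2) *\<^sub>R (a - b)) \<le> q n a + q n b"
    and pointwise: "\<And>x. \<exists>M. \<forall>n. q n x \<le> M"
  shows "\<exists>r>0. \<exists>M. \<forall>x n. norm x < r \<longrightarrow> q n x \<le> M"
proof -
  define F where "F m = {x. \<forall>n. q n x \<le> real m}" for m :: nat
  have closed: "closed (F m)" for m
  proof -
    have "F m = (\<Inter>n. {x. q n x \<le> real m})" by (auto simp: F_def)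
    moreover have "closed {x. q n x \<le> real m}" for n
      by (intro closed_Collect_le cont continuous_on_const)
    ultimately show ?thesis by (auto intro!: closed_INT)
  qed
  have cover: "(\<Union>m. F m) = UNIV"
  proof -
    have "x \<in> (\<Union>m. F m)" for x
    proof -
      obtain M where M: "\<forall>n. q n x \<le> M" using pointwise by blast
      obtain m :: nat where "M \<le> real m" using real_arch_simple by blast
      then have "x \<in> F m" using M by (auto simp: F_def intro: order_trans)
      then show ?thesis by blast
    qed
    then show ?thesis by blast
  qed
  have "\<exists>m. interior (F m) \<noteq> {}"
  proof (rule ccontr)
    assume *: "\<nexists>m. interior (F m) \<noteq> {}"
    have "euclidean interior_of \<Union>(range F) = {}"
    proof (rule Baire_category_alt)
      show "completely_metrizable_space (euclidean :: 'a topology) \<or>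
        locally_compact_space (euclidean :: 'a topology) \<and> regular_space (euclidean :: 'a topology)"
        by (simp add: completely_metrizable_space_euclidean)
      show "countable (range F)" by simp
      fix T assume "T \<in> range F"
      then show "closedin euclidean T \<and> euclidean interior_of T = {}"
        using * closed by auto
    qed
    then show False using cover by simp
  qed
  then obtain m a where "a \<in> interior (F m)" by blast
  then obtain e where e: "0 < e" "ball a e \<subseteq> F m"
    by (meson interior_subset open_contains_ball open_interior order_trans)
  have "q n x \<le> 2 * real m" if "norm x < e / 2" for x n
  proof -
    have "a + 2 *\<^sub>R x \<in> ball a e" "a \<in> ball a e" using that e(1) by (simp_all add: dist_norm)
    then have "a + 2 *\<^sub>R x \<in> F m" "a \<in> F m" using e(2) by blast+
    then have "q n (a + 2 *\<^sub>R x) \<le> real m" "q n a \<le> real m" by (simp_all add: F_def)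
    moreover have "(1/2) *\<^sub>R ((a + 2 *\<^sub>R x) - a) = x" by simp
    ultimately show ?thesis using half[of n "a + 2 *\<^sub>R x" a] by simp
  qed
  then show ?thesis using e(1) by (intro exI[of _ "e / 2"]) auto
qed

lemma weak_star_null_norm_bounded:
  fixes f :: "nat \<Rightarrow> 'a::banach \<Rightarrow>\<^sub>L real"
  assumes "weak_star_null f"
  shows "\<exists>M. \<forall>n. norm (f n) \<le> M"
proof -
  have "\<exists>r>0. \<exists>M. \<forall>x n. norm x < r \<longrightarrow> \<bar>blinfun_apply (f n) x\<bar> \<le> M"
  proof (rule uniform_boundedness)
    show "continuous_on UNIV (\<lambda>x. \<bar>blinfun_apply (f n) x\<bar>)" for n
      by (intro continuous_intros)
    show "\<bar>blinfun_apply (f n) ((1/2) *\<^sub>R (a - b))\<bar> \<le> \<bar>blinfun_apply (f n) a\<bar> + \<bar>blinfun_apply (f n) b\<bar>" for n a b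
      unfolding blinfun.scaleR_right blinfun.diff_right by simp
    show "\<exists>M. \<forall>n. \<bar>blinfun_apply (f n) x\<bar> \<le> M" for x
    proof -
      have "(\<lambda>n. blinfun_apply (f n) x) \<longlonglongrightarrow> 0" using assms by (simp add: weak_star_null_def)
      then have "Bseq (\<lambda>n. blinfun_apply (f n) x)" by (meson convergentI convergent_imp_Bseq)
      then show ?thesis by (auto simp: Bseq_def)
    qed
  qed
  then obtain r M where r: "r > 0" and M: "\<And>x n. norm x < r \<Longrightarrow> \<bar>blinfun_apply (f n) x\<bar> \<le> M"
    by blast
  have "norm (f n) \<le> 2 * M / r" for n
  proof (rule norm_blinfun_bound)
    have "0 \<le> M" using M[of 0] r by (simp add: blinfun.zero_right)
    then show "0 \<le> 2 * M / r" using r by simp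
    fix x
    show "norm (blinfun_apply (f n) x) \<le> 2 * M / r * norm x"
    proof (cases "x = 0")
      case False
      define s where "s = r / (2 * norm x)"
      have s: "s > 0" "norm (s *\<^sub>R x) < r" using False r by (simp_all add: s_def)
      then have "s * \<bar>blinfun_apply (f n) x\<bar> \<le> M"
        using M[OF s(2), of n] by (simp add: blinfun.scaleR_right abs_mult)
      then show ?thesis using False r by (simp add: s_def field_simps)
    qed (simp add: blinfun.zero_right)
  qed
  then show ?thesis by blast
qed

text \<open>The \<open>p\<close>-th power sums of a weakly \<open>p\<close>-summable sequence are bounded uniformly on
  bounded sets of functionals.  They are continuous functions of the functional, and they are bounded
  pointwise, so the uniform boundedness principle on the dual space applies.\<close>
lemma weakly_p_summable_uniform:
  fixes x :: "nat \<Rightarrow> 'a::banach"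
  assumes p: "1 \<le> p" and x: "weakly_p_summable p x" and K: "0 \<le> K"
  shows "\<exists>C. \<forall>f :: 'a \<Rightarrow>\<^sub>L real. norm f \<le> K \<longrightarrow> (\<forall>N. (\<Sum>k<N. \<bar>blinfun_apply f (x k)\<bar> powr p) \<le> C)"
proof -
  have "\<exists>r>0. \<exists>M. \<forall>(f :: 'a \<Rightarrow>\<^sub>L real) N. norm f < r \<longrightarrow> (\<Sum>k<N. \<bar>blinfun_apply f (x k)\<bar> powr p) \<le> M"
  proof (rule uniform_boundedness)
    fix N :: nat
    show "continuous_on UNIV (\<lambda>f :: 'a \<Rightarrow>\<^sub>L real. \<Sum>k<N. \<bar>blinfun_apply f (x k)\<bar> powr p)"
      using p by (intro continuous_intros continuous_on_powr') auto
    fix f g :: "'a \<Rightarrow>\<^sub>L real"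
    have "\<bar>blinfun_apply ((1/2) *\<^sub>R (f - g)) (x k)\<bar> powr p
        \<le> \<bar>blinfun_apply f (x k)\<bar> powr p + \<bar>blinfun_apply g (x k)\<bar> powr p" for k
    proof -
      let ?a = "blinfun_apply f (x k)" and ?b = "blinfun_apply g (x k)"
      have "\<bar>blinfun_apply ((1/2) *\<^sub>R (f - g)) (x k)\<bar> \<le> max \<bar>?a\<bar> \<bar>?b\<bar>"
        unfolding blinfun.scaleR_left blinfun.diff_left by (simp add: max_def) linarith
      then have "\<bar>blinfun_apply ((1/2) *\<^sub>R (f - g)) (x k)\<bar> powr p \<le> max \<bar>?a\<bar> \<bar>?b\<bar> powr p"
        using p by (intro powr_mono2) auto
      also have "\<dots> \<le> \<bar>?a\<bar> powr p + \<bar>?b\<bar> powr p" by (simp add: max_def)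
      finally show ?thesis .
    qed
    then show "(\<Sum>k<N. \<bar>blinfun_apply ((1/2) *\<^sub>R (f - g)) (x k)\<bar> powr p)
      \<le> (\<Sum>k<N. \<bar>blinfun_apply f (x k)\<bar> powr p) + (\<Sum>k<N. \<bar>blinfun_apply g (x k)\<bar> powr p)"
      unfolding sum.distrib[symmetric] by (intro sum_mono)
  next
    fix f :: "'a \<Rightarrow>\<^sub>L real"
    have "summable (\<lambda>k. \<bar>blinfun_apply f (x k)\<bar> powr p)"
      using x by (simp add: weakly_p_summable_def)
    then have "(\<Sum>k<N. \<bar>blinfun_apply f (x k)\<bar> powr p) \<le> (\<Sum>k. \<bar>blinfun_apply f (x k)\<bar> powr p)" for N
      by (intro sum_le_suminf) auto
    then show "\<exists>M. \<forall>N. (\<Sum>k<N. \<bar>blinfun_apply f (x k)\<bar> powr p) \<le> M" by blast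
  qed
  then obtain r M where r: "r > 0"
    and M: "\<And>(f :: 'a \<Rightarrow>\<^sub>L real) N. norm f < r \<Longrightarrow> (\<Sum>k<N. \<bar>blinfun_apply f (x k)\<bar> powr p) \<le> M"
    by blast
  \<comment> \<open>Scaling by \<open>s\<close> moves the ball of radius \<open>K\<close> into the open ball of radius \<open>r\<close>.\<close>
  define s where "s = r / (K + 1)"
  have s: "s > 0" using r K by (simp add: s_def)
  have "(\<Sum>k<N. \<bar>blinfun_apply f (x k)\<bar> powr p) \<le> M / s powr p" if "norm f \<le> K" for f :: "'a \<Rightarrow>\<^sub>L real" and N
  proof -
    have "norm (s *\<^sub>R f) \<le> s * K" using s that by simp
    also have "\<dots> < r" using r K by (simp add: s_def field_simps)
    finally have "(\<Sum>k<N. \<bar>blinfun_apply (s *\<^sub>R f) (x k)\<bar> powr p) \<le> M" by (rule M)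
    moreover have "\<bar>blinfun_apply (s *\<^sub>R f) (x k)\<bar> powr p = s powr p * \<bar>blinfun_apply f (x k)\<bar> powr p" for k
      using s by (simp add: blinfun.scaleR_left abs_mult powr_mult)
    ultimately have "s powr p * (\<Sum>k<N. \<bar>blinfun_apply f (x k)\<bar> powr p) \<le> M"
      by (simp add: sum_distrib_left)
    then show ?thesis using s by (simp add: field_simps)
  qed
  then show ?thesis by blast
qed

section \<open>Norming functionals\<close>

definition sublinear :: "('a::real_vector \<Rightarrow> real) \<Rightarrow> bool" where
  "sublinear q \<longleftrightarrow> (\<forall>x y. q (x + y) \<le> q x + q y) \<and> (\<forall>c\<ge>0. \<forall>x. q (c *\<^sub>R x) = c * q x)"

lemma sublinear_add: "sublinear q \<Longrightarrow> q (x + y) \<le> q x + q y"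
  and sublinear_scaleR: "sublinear q \<Longrightarrow> 0 \<le> c \<Longrightarrow> q (c *\<^sub>R x) = c * q x"
  by (simp_all add: sublinear_def)

lemma sublinear_0: "sublinear q \<Longrightarrow> q 0 = 0"
  using sublinear_scaleR[of q 0 0] by simp

lemma sublinear_ge_uminus: "sublinear q \<Longrightarrow> - q (- x) \<le> q x"
  using sublinear_add[of q x "- x"] sublinear_0[of q] by simp

lemma sublinearI:
  assumes "\<And>x y. q (x + y) \<le> q x + q y" "q 0 = 0"
    and le: "\<And>c x. 0 < c \<Longrightarrow> q (c *\<^sub>R x) \<le> c * q x"
  shows "sublinear q"
proof -
  have "q (c *\<^sub>R x) = c * q x" if "0 \<le> c" for c x
  proof (cases "c = 0")
    case False
    then have c: "0 < c" using that by simp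
    then have "q (inverse c *\<^sub>R (c *\<^sub>R x)) \<le> inverse c * q (c *\<^sub>R x)" by (intro le) simp
    then have "c * q x \<le> q (c *\<^sub>R x)" using c by (simp add: field_simps)
    then show ?thesis using le[OF c] by (simp add: antisym)
  qed (simp add: assms(2))
  then show ?thesis using assms(1) by (simp add: sublinear_def)
qed

text \<open>Lowering \<open>q\<close> along the direction \<open>y\<close>: the infimum of
  \<open>q (x + t y) - t q y\<close> over \<open>t \<ge> 0\<close> is again sublinear and takes a value of at most
  \<open>- q y\<close> at \<open>- y\<close>.\<close>
lemma sublinear_tilt:
  fixes q :: "'a::real_vector \<Rightarrow> real"
  assumes q: "sublinear q"
  shows "\<exists>q'. sublinear q' \<and> (\<forall>x. q' x \<le> q x) \<and> q' (- y) \<le> - q y"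
proof -
  define g where "g x t = q (x + t *\<^sub>R y) - t * q y" for x t
  define q' where "q' x = (INF t\<in>{0..}. g x t)" for x
  have lower: "- q (- x) \<le> g x t" if "t \<ge> 0" for x t
  proof -
    have "q (t *\<^sub>R y) \<le> q (x + t *\<^sub>R y) + q (- x)"
      using sublinear_add[OF q, of "x + t *\<^sub>R y" "- x"] by simp
    then show ?thesis using sublinear_scaleR[OF q that] by (simp add: g_def)
  qed
  have bdd: "bdd_below (g x ` {0..})" for x
    using lower by (intro bdd_belowI2[where m = "- q (- x)"]) auto
  have upper: "q' x \<le> g x t" if "t \<ge> 0" for x t
    unfolding q'_def using that by (intro cINF_lower bdd) auto
  have greatest: "B \<le> q' x" if "\<And>t. t \<ge> 0 \<Longrightarrow> B \<le> g x t" for x B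
    unfolding q'_def using that by (intro cINF_greatest) auto
  have "sublinear q'"
  proof (rule sublinearI)
    fix x1 x2
    have "q' (x1 + x2) - g x1 s \<le> q' x2" if s: "s \<ge> 0" for s
    proof (rule greatest)
      fix t :: real assume t: "t \<ge> 0"
      have "g (x1 + x2) (s + t) \<le> g x1 s + g x2 t"
      proof -
        have "x1 + x2 + (s + t) *\<^sub>R y = (x1 + s *\<^sub>R y) + (x2 + t *\<^sub>R y)"
          by (simp add: scaleR_add_left)
        then have "g (x1 + x2) (s + t) = q ((x1 + s *\<^sub>R y) + (x2 + t *\<^sub>R y)) - (s + t) * q y"
          by (simp only: g_def)
        then show ?thesis
          using sublinear_add[OF q, of "x1 + s *\<^sub>R y" "x2 + t *\<^sub>R y"]
          unfolding g_def distrib_right by linarith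
      qed
      then show "q' (x1 + x2) - g x1 s \<le> g x2 t" using upper[of "s + t" "x1 + x2"] s t by simp
    qed
    then have "q' (x1 + x2) - q' x2 \<le> g x1 s" if "s \<ge> 0" for s using that by fastforce
    then have "q' (x1 + x2) - q' x2 \<le> q' x1" by (rule greatest)
    then show "q' (x1 + x2) \<le> q' x1 + q' x2" by simp
  next
    have "g 0 t = 0" if "t \<ge> 0" for t using sublinear_scaleR[OF q that] by (simp add: g_def)
    then show "q' 0 = 0" by (intro antisym greatest order_trans[OF upper[of 0 0]]) simp_all
  next
    fix c :: real and x assume c: "0 < c"
    have "q' (c *\<^sub>R x) / c \<le> q' x"
    proof (rule greatest)
      fix t :: real assume t: "t \<ge> 0"
      have "g (c *\<^sub>R x) (c * t) = c * g x t"
        using sublinear_scaleR[OF q, of c "x + t *\<^sub>R y"] c by (simp add: g_def algebra_simps)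
      then have "q' (c *\<^sub>R x) \<le> c * g x t" using upper[of "c * t" "c *\<^sub>R x"] c t by simp
      then show "q' (c *\<^sub>R x) / c \<le> g x t" using c by (simp add: field_simps)
    qed
    then show "q' (c *\<^sub>R x) \<le> c * q' x" using c by (simp add: field_simps)
  qed
  moreover have "q' x \<le> q x" for x using upper[of 0 x] by (simp add: g_def)
  moreover have "q' (- y) \<le> - q y" using upper[of 1 "- y"] sublinear_0[OF q] by (simp add: g_def)
  ultimately show ?thesis by blast
qed

text \<open>The Hahn--Banach theorem in the form that works with total functions only.  A minimal sublinear
  functional below \<open>p\<close> exists by Zorn's lemma; it cannot be lowered by tilting, and this
  makes it odd, hence linear.\<close>
lemma sublinear_dominates_linear:
  fixes p :: "'a::real_vector \<Rightarrow> real"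
  assumes p: "sublinear p"
  shows "\<exists>m. linear m \<and> (\<forall>x. m x \<le> p x)"
proof -
  define A where "A = {q. sublinear q \<and> (\<forall>x. q x \<le> p x)}"
  define P where "P a b \<longleftrightarrow> (\<forall>x. b x \<le> a x)" for a b :: "'a \<Rightarrow> real"
  have "\<exists>m\<in>A. \<forall>a\<in>A. P m a \<longrightarrow> a = m"
  proof (rule predicate_Zorn)
    show "partial_order_on A (relation_of P A)"
      by (rule partial_order_on_relation_ofI) (auto simp: P_def fun_eq_iff intro: order_trans antisym)
    fix C assume C: "C \<in> Chains (relation_of P A)"
    have CA: "q \<in> A" if "q \<in> C" for q using C that by (auto simp: Chains_def relation_of_def)
    have chain: "P a b \<or> P b a" if "a \<in> C" "b \<in> C" for a b
      using C that by (auto simp: Chains_def relation_of_def)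
    show "\<exists>u\<in>A. \<forall>a\<in>C. P a u"
    proof (cases "C = {}")
      case True
      then show ?thesis using p by (auto simp: A_def)
    next
      case False
      define u where "u x = (INF q\<in>C. q x)" for x
      have sub: "sublinear q" "\<And>x. q x \<le> p x" if "q \<in> C" for q
        using CA[OF that] by (auto simp: A_def)
      have lower: "- p (- x) \<le> q x" if "q \<in> C" for q x
        using sublinear_ge_uminus[OF sub(1)[OF that], of x] sub(2)[OF that, of "- x"] by simp
      have upper: "u x \<le> q x" if "q \<in> C" for q x
        unfolding u_def using that lower by (intro cINF_lower bdd_belowI2[where m = "- p (- x)"]) auto
      have greatest: "B \<le> u x" if "\<And>q. q \<in> C \<Longrightarrow> B \<le> q x" for B x
        unfolding u_def using False that by (intro cINF_greatest) auto
      have "sublinear u"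
      proof (rule sublinearI)
        fix x y
        have "u (x + y) - a x \<le> u y" if a: "a \<in> C" for a
        proof (rule greatest)
          fix b assume b: "b \<in> C"
          obtain c where c: "c \<in> C" "c x \<le> a x" "c y \<le> b y"
            using chain[OF a b] a b by (auto simp: P_def)
          have "u (x + y) \<le> c (x + y)" by (rule upper[OF c(1)])
          also have "\<dots> \<le> c x + c y" by (rule sublinear_add[OF sub(1)[OF c(1)]])
          finally show "u (x + y) - a x \<le> b y" using c by simp
        qed
        then have "u (x + y) - u y \<le> a x" if "a \<in> C" for a using that by fastforce
        then have "u (x + y) - u y \<le> u x" by (rule greatest)
        then show "u (x + y) \<le> u x + u y" by simp
      next
        obtain q where q: "q \<in> C" using False by blast
        have "u 0 \<le> 0" using upper[OF q, of 0] sublinear_0[OF sub(1)[OF q]] by simp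
        moreover have "0 \<le> u 0" by (intro greatest) (simp add: sublinear_0 sub(1))
        ultimately show "u 0 = 0" by (rule antisym)
      next
        fix c :: real and x assume c: "0 < c"
        have "u (c *\<^sub>R x) / c \<le> u x"
        proof (rule greatest)
          fix q assume q: "q \<in> C"
          have "u (c *\<^sub>R x) \<le> c * q x"
            using upper[OF q, of "c *\<^sub>R x"] sublinear_scaleR[OF sub(1)[OF q], of c x] c by simp
          then show "u (c *\<^sub>R x) / c \<le> q x" using c by (simp add: field_simps)
        qed
        then show "u (c *\<^sub>R x) \<le> c * u x" using c by (simp add: field_simps)
      qed
      moreover obtain q where q: "q \<in> C" using False by blast
      have "u x \<le> p x" for x using upper[OF q, of x] sub(2)[OF q, of x] by simp
      ultimately have "u \<in> A" by (simp add: A_def)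
      then show ?thesis using upper by (auto simp: P_def)
    qed
  qed
  then obtain m where "m \<in> A" and min: "\<forall>a\<in>A. P m a \<longrightarrow> a = m" by blast
  then have m: "sublinear m" "\<And>x. m x \<le> p x" by (auto simp: A_def)
  have minimal: "a = m" if "sublinear a" "\<And>x. a x \<le> m x" for a
  proof -
    have "a x \<le> p x" for x using that(2) m(2) by (rule order_trans)
    then show ?thesis using min that by (simp add: A_def P_def)
  qed
  have neg: "m (- y) = - m y" for y
  proof -
    obtain q' where "sublinear q'" "\<forall>x. q' x \<le> m x" "q' (- y) \<le> - m y"
      using sublinear_tilt[OF m(1)] by blast
    then have "m (- y) \<le> - m y" using minimal by blast
    then show ?thesis using sublinear_ge_uminus[OF m(1), of "- y"] by simp
  qed
  have "m (x + y) = m x + m y" for x y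
    using sublinear_add[OF m(1), of x y] sublinear_add[OF m(1), of "x + y" "- y"] neg by simp
  moreover have "m (c *\<^sub>R x) = c * m x" for c x
  proof (cases "c \<ge> 0")
    case False
    then have "m ((- c) *\<^sub>R x) = (- c) * m x" by (intro sublinear_scaleR m) simp
    then show ?thesis using neg[of "c *\<^sub>R x"] by simp
  qed (rule sublinear_scaleR[OF m(1)])
  ultimately have "linear m" by (intro linearI) auto
  then show ?thesis using m(2) by blast
qed

text \<open>Tilting the norm along \<open>x\<close> before applying Hahn--Banach forces the value at \<open>x\<close>.\<close>
lemma norming_functional:
  fixes x :: "'a::real_normed_vector"
  shows "\<exists>f :: 'a \<Rightarrow>\<^sub>L real. norm f \<le> 1 \<and> norm x \<le> blinfun_apply f x"
proof -
  have "sublinear (norm :: 'a \<Rightarrow> real)" by (simp add: sublinear_def norm_triangle_ineq)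
  then obtain q where q: "sublinear q" "\<forall>y. q y \<le> norm y" "q (- x) \<le> - norm x"
    using sublinear_tilt by blast
  then obtain m where m: "linear m" "\<forall>y. m y \<le> q y" using sublinear_dominates_linear by blast
  have bnd: "norm (m y) \<le> norm y" for y
  proof -
    have "m y \<le> norm y" "m (- y) \<le> norm (- y)" using m q by (meson order_trans)+
    then show ?thesis using linear_neg[OF m(1), of y] by simp
  qed
  have lin: "bounded_linear m"
    by (rule bounded_linear_intro[where K = 1]) (use m(1) bnd in \<open>auto simp: linear_add linear_cmul\<close>)
  show ?thesis
  proof (intro exI[of _ "Blinfun m"] conjI)
    show "norm (Blinfun m) \<le> 1"
      using bnd by (intro norm_blinfun_bound) (auto simp: bounded_linear_Blinfun_apply[OF lin])
    have "m (- x) \<le> - norm x" using m(2) q(3) by (meson order_trans)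
    then show "norm x \<le> blinfun_apply (Blinfun m) x"
      using linear_neg[OF m(1), of x] by (simp add: bounded_linear_Blinfun_apply[OF lin])
  qed
qed

lemma weakly_p_summable_norm_bounded:
  fixes x :: "nat \<Rightarrow> 'a::banach"
  assumes p: "1 \<le> p" and x: "weakly_p_summable p x"
  shows "\<exists>B. \<forall>k. norm (x k) \<le> B"
proof -
  obtain C where C: "\<And>(f :: 'a \<Rightarrow>\<^sub>L real) N. norm f \<le> 1 \<Longrightarrow> (\<Sum>k<N. \<bar>blinfun_apply f (x k)\<bar> powr p) \<le> C"
    using weakly_p_summable_uniform[OF p x, of 1] by auto
  have "norm (x k) \<le> max 1 C" for k
  proof (cases "norm (x k) \<le> 1")
    case False
    obtain f :: "'a \<Rightarrow>\<^sub>L real" where f: "norm f \<le> 1" "norm (x k) \<le> blinfun_apply f (x k)"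
      using norming_functional by blast
    have "norm (x k) powr 1 \<le> norm (x k) powr p" using p False by (intro powr_mono) auto
    also have "\<dots> \<le> \<bar>blinfun_apply f (x k)\<bar> powr p" using f p by (intro powr_mono2) auto
    also have "\<dots> \<le> (\<Sum>i<Suc k. \<bar>blinfun_apply f (x i)\<bar> powr p)" by (simp add: sum_nonneg)
    also have "\<dots> \<le> C" by (rule C[OF f(1)])
    finally show ?thesis using False by simp
  qed simp
  then show ?thesis by blast
qed

section \<open>Disjoint minorants of weakly p-summable sequences\<close>

text \<open>Averaging over signs: changing the sign of the \<open>j\<close>-th term pairs the sign patterns, and
  the two moduli in a pair add up to at least \<open>2 \<bar>b j\<bar>\<close>.  A pattern is encoded by the
  set \<open>A\<close> of indices with a plus sign.\<close>
lemma abs_le_sign_sum: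
  fixes b :: "nat \<Rightarrow> 'a::banach_lattice"
  assumes j: "j < N"
  shows "(2 ^ N) *\<^sub>R \<bar>b j\<bar> \<le> (\<Sum>A\<in>Pow {..<N}. \<bar>\<Sum>k<N. if k \<in> A then b k else - b k\<bar>)"
proof -
  define s where "s A = (\<Sum>k<N. if k \<in> A then b k else - b k)" for A
  define flip where "flip A = (if j \<in> A then A - {j} else insert j A)" for A
  have pair: "2 *\<^sub>R \<bar>b j\<bar> \<le> \<bar>s A\<bar> + \<bar>s (flip A)\<bar>" for A
  proof -
    have "s A - s (flip A) = (\<Sum>k<N. if k = j then (if j \<in> A then 2 else - 2) *\<^sub>R b j else 0)"
      unfolding s_def sum_subtractf[symmetric]
    proof (rule sum.cong)
      fix k
      show "(if k \<in> A then b k else - b k) - (if k \<in> flip A then b k else - b k)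
        = (if k = j then (if j \<in> A then 2 else - 2) *\<^sub>R b j else 0)"
      proof (cases "k = j")
        case True
        have "k \<in> flip A \<longleftrightarrow> j \<notin> A" using True by (simp add: flip_def)
        moreover have "b j - - b j = 2 *\<^sub>R b j" "- b j - b j = (- 2) *\<^sub>R b j"
          unfolding scaleR_minus_left scaleR_2 by simp_all
        ultimately show ?thesis using True by (cases "j \<in> A") simp_all
      next
        case False
        then have "k \<in> flip A \<longleftrightarrow> k \<in> A" by (simp add: flip_def)
        then show ?thesis using False by simp
      qed
    qed simp
    also have "\<dots> = (if j \<in> A then 2 else - 2) *\<^sub>R b j" using j by simp
    finally have "\<bar>s A - s (flip A)\<bar> = 2 *\<^sub>R \<bar>b j\<bar>" by (simp only: abs_scaleR) simp
    then show ?thesis using abs_triangle_ineq4[of "s A" "s (flip A)"] by simp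
  qed
  have "(\<Sum>A\<in>Pow {..<N}. \<bar>s (flip A)\<bar>) = (\<Sum>A\<in>Pow {..<N}. \<bar>s A\<bar>)"
    using j by (intro sum.reindex_bij_witness[of _ flip flip]) (auto simp: flip_def)
  then have "2 *\<^sub>R (\<Sum>A\<in>Pow {..<N}. \<bar>s A\<bar>) = (\<Sum>A\<in>Pow {..<N}. \<bar>s A\<bar> + \<bar>s (flip A)\<bar>)"
    by (simp add: sum.distrib scaleR_2)
  also have "\<dots> \<ge> (\<Sum>A\<in>Pow {..<N}. 2 *\<^sub>R \<bar>b j\<bar>)" by (intro sum_mono pair)
  also have "(\<Sum>A\<in>Pow {..<N}. 2 *\<^sub>R \<bar>b j\<bar>) = 2 *\<^sub>R ((2 ^ N) *\<^sub>R \<bar>b j\<bar>)"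
    by (simp add: sum_constant_scaleR card_Pow)
  finally have "2 *\<^sub>R ((2 ^ N) *\<^sub>R \<bar>b j\<bar>) \<le> 2 *\<^sub>R (\<Sum>A\<in>Pow {..<N}. \<bar>s A\<bar>)" .
  from scaleR_left_mono[OF this, of "1/2"] show ?thesis by (simp add: s_def)
qed

text \<open>A substitute for Hoelder's inequality in which the \<open>t\<close>-sum can be absorbed into the left
  side of an estimate.\<close>
lemma powr_young:
  fixes s t :: real
  assumes "1 \<le> p" "0 \<le> t" "0 \<le> s"
  shows "t powr (p - 1) * s \<le> t powr p / 2 + 2 powr p * s powr p"
proof (cases "s \<le> t / 2")
  case True
  have "t powr (p - 1) * s \<le> t powr (p - 1) * (t / 2)" using True by (intro mult_left_mono) auto
  also have "\<dots> = t powr p / 2" using assms by (cases "t = 0") (simp_all add: powr_diff)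
  finally show ?thesis by (simp add: add_increasing2)
next
  case False
  then have s: "0 < s" using assms by auto
  have "t powr (p - 1) * s \<le> (2 * s) powr (p - 1) * (2 * s)"
    using assms False by (intro mult_mono powr_mono2) auto
  also have "\<dots> = (2 * s) powr p" using s by (simp add: powr_diff)
  also have "\<dots> = 2 powr p * s powr p" using s by (simp add: powr_mult)
  finally show ?thesis by (simp add: add_increasing)
qed

text \<open>Put \<open>t\<^sub>k = h y\<^sub>k\<close> and \<open>a\<^sub>k = t\<^sub>k\<^bsup>p-1\<^esup>\<close>, so that
  the sum \<open>S\<close> of the \<open>t\<^sub>k\<^bsup>p\<^esup>\<close> equals
  \<open>h (\<Sum> a\<^sub>k y\<^sub>k)\<close>.  Each \<open>a\<^sub>k y\<^sub>k\<close> lies below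
  \<open>\<bar>a\<^sub>k x\<^sub>k\<bar>\<close>, hence below the average of \<open>\<bar>\<Sum> \<plusminus> a\<^sub>k x\<^sub>k\<bar>\<close>
  over all signs; by disjointness so does their sum.  The functional \<open>h\<close> on a modulus is the
  value of some functional of norm at most \<open>5 \<parallel>h\<parallel>\<close> without the modulus, and the uniform
  bound on \<open>p\<close>-th power sums together with the inequality above gives
  \<open>S \<le> S / 2 + const\<close>.\<close>
lemma disjoint_minorant_p_sums_bounded:
  fixes x y :: "nat \<Rightarrow> 'a::banach_lattice"
  assumes p: "1 \<le> p" and x: "weakly_p_summable p x"
    and pos: "\<And>k. 0 \<le> y k" and disj: "\<And>j k. j \<noteq> k \<Longrightarrow> inf (y j) (y k) = 0"
    and dom: "\<And>k. y k \<le> \<bar>x k\<bar>"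
    and h: "positive_functional h"
  shows "\<exists>C. \<forall>N. (\<Sum>k<N. blinfun_apply h (y k) powr p) \<le> C"
proof -
  obtain C where C: "\<And>(f :: 'a \<Rightarrow>\<^sub>L real) N. norm f \<le> 5 * norm h \<Longrightarrow>
      (\<Sum>k<N. \<bar>blinfun_apply f (x k)\<bar> powr p) \<le> C"
    using weakly_p_summable_uniform[OF p x, of "5 * norm h"] by auto
  define t where "t k = blinfun_apply h (y k)" for k
  have t: "0 \<le> t k" for k using h pos by (simp add: t_def positive_functional_def)
  define a where "a k = t k powr (p - 1)" for k
  have a: "0 \<le> a k" for k by (simp add: a_def)
  have at: "a k * t k = t k powr p" for k
    using t[of k] by (cases "t k = 0") (simp_all add: a_def powr_diff)
  have "(\<Sum>k<N. t k powr p) \<le> 2 * (2 powr p * C)" for N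
  proof -
    define s where "s A = (\<Sum>k<N. if k \<in> A then a k *\<^sub>R x k else - (a k *\<^sub>R x k))" for A
    define S where "S = (\<Sum>k<N. t k powr p)"
    have sA: "blinfun_apply h \<bar>s A\<bar> \<le> S / 2 + 2 powr p * C" for A
    proof -
      obtain g where g: "norm g \<le> 5 * norm h" "blinfun_apply h \<bar>s A\<bar> = blinfun_apply g (s A)"
        using functional_attaining_modulus[OF h] by metis
      have "blinfun_apply g (s A) = (\<Sum>k<N. blinfun_apply g (if k \<in> A then a k *\<^sub>R x k else - (a k *\<^sub>R x k)))"
        by (simp only: s_def blinfun.sum_right)
      also have "\<dots> \<le> (\<Sum>k<N. t k powr p / 2 + 2 powr p * \<bar>blinfun_apply g (x k)\<bar> powr p)"
      proof (rule sum_mono)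
        fix k
        have "blinfun_apply g (if k \<in> A then a k *\<^sub>R x k else - (a k *\<^sub>R x k)) \<le> \<bar>a k * blinfun_apply g (x k)\<bar>"
          by (simp add: blinfun.minus_right blinfun.scaleR_right abs_ge_self abs_ge_minus_self)
        also have "\<dots> = a k * \<bar>blinfun_apply g (x k)\<bar>" using a[of k] by (simp add: abs_mult)
        also have "\<dots> \<le> t k powr p / 2 + 2 powr p * \<bar>blinfun_apply g (x k)\<bar> powr p"
          unfolding a_def by (intro powr_young p t) simp
        finally show "blinfun_apply g (if k \<in> A then a k *\<^sub>R x k else - (a k *\<^sub>R x k))
          \<le> t k powr p / 2 + 2 powr p * \<bar>blinfun_apply g (x k)\<bar> powr p" .
      qed
      also have "\<dots> = S / 2 + 2 powr p * (\<Sum>k<N. \<bar>blinfun_apply g (x k)\<bar> powr p)"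
        by (simp add: S_def sum.distrib sum_distrib_left sum_divide_distrib)
      also have "\<dots> \<le> S / 2 + 2 powr p * C" using C[OF g(1), of N] by simp
      finally show ?thesis using g(2) by simp
    qed
    define W where "W = (\<Sum>A\<in>Pow {..<N}. \<bar>s A\<bar>)"
    have "(\<Sum>k<N. (2 ^ N * a k) *\<^sub>R y k) \<le> W"
    proof (rule disjoint_sum_le)
      show "0 \<le> (2 ^ N * a k) *\<^sub>R y k" for k
        using a pos by (intro scaleR_nonneg_nonneg) auto
      show "inf ((2 ^ N * a i) *\<^sub>R y i) ((2 ^ N * a k) *\<^sub>R y k) = 0" if ik: "i \<noteq> k" for i k
      proof -
        have 1: "inf ((2 ^ N * a i) *\<^sub>R y i) (y k) = 0"
          using a by (intro inf_scaleR_eq_0 pos disj ik) auto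
        have "inf ((2 ^ N * a k) *\<^sub>R y k) ((2 ^ N * a i) *\<^sub>R y i) = 0"
        proof (rule inf_scaleR_eq_0)
          show "inf (y k) ((2 ^ N * a i) *\<^sub>R y i) = 0" using 1 by (simp only: inf_commute)
          show "0 \<le> (2 ^ N * a i) *\<^sub>R y i" using a pos by (intro scaleR_nonneg_nonneg) auto
        qed (use a pos in auto)
        then show ?thesis by (simp only: inf_commute)
      qed
      show "(2 ^ N * a k) *\<^sub>R y k \<le> W" if k: "k \<in> {..<N}" for k
      proof -
        have "(2 ^ N * a k) *\<^sub>R y k \<le> (2 ^ N * a k) *\<^sub>R \<bar>x k\<bar>"
          using a dom by (intro scaleR_left_mono) auto
        also have "\<dots> = (2 ^ N) *\<^sub>R \<bar>a k *\<^sub>R x k\<bar>"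
          using a[of k] by (simp add: abs_scaleR)
        also have "\<dots> \<le> W" unfolding W_def s_def using k by (intro abs_le_sign_sum) auto
        finally show ?thesis .
      qed
      show "0 \<le> W" unfolding W_def by (intro sum_nonneg abs_ge_zero)
    qed simp
    then have "blinfun_apply h (\<Sum>k<N. (2 ^ N * a k) *\<^sub>R y k) \<le> blinfun_apply h W"
      by (rule positive_functional_mono[OF h])
    moreover have "blinfun_apply h (\<Sum>k<N. (2 ^ N * a k) *\<^sub>R y k) = 2 ^ N * S"
      by (simp add: blinfun.sum_right blinfun.scaleR_right t_def[symmetric] mult.assoc at S_def sum_distrib_left)
    moreover have "blinfun_apply h W \<le> (\<Sum>A\<in>Pow {..<N}. S / 2 + 2 powr p * C)"
      unfolding W_def blinfun.sum_right by (intro sum_mono sA)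
    moreover have "(\<Sum>A\<in>Pow {..<N}. S / 2 + 2 powr p * C) = 2 ^ N * (S / 2 + 2 powr p * C)"
      by (simp add: card_Pow)
    ultimately have "2 ^ N * S \<le> 2 ^ N * (S / 2 + 2 powr p * C)" by linarith
    then have "S \<le> S / 2 + 2 powr p * C" by simp
    then show ?thesis by (simp add: S_def)
  qed
  then show ?thesis unfolding t_def by blast
qed

text \<open>The modulus of a weakly \<open>p\<close>-summable sequence can fail to be weakly \<open>p\<close>-summable, but
  disjoint sequences below it inherit the property.  Both implications of the theorem rest on this.\<close>
lemma weakly_p_summable_disjoint_minorant:
  fixes x y :: "nat \<Rightarrow> 'a::banach_lattice"
  assumes p: "1 \<le> p" and x: "weakly_p_summable p x"
    and pos: "\<And>k. 0 \<le> y k" and disj: "\<And>j k. j \<noteq> k \<Longrightarrow> inf (y j) (y k) = 0"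
    and dom: "\<And>k. y k \<le> \<bar>x k\<bar>"
  shows "weakly_p_summable p y"
  unfolding weakly_p_summable_def
proof
  fix f :: "'a \<Rightarrow>\<^sub>L real"
  obtain h where h: "positive_functional h" "\<And>y. 0 \<le> y \<Longrightarrow> \<bar>blinfun_apply f y\<bar> \<le> blinfun_apply h y"
    using positive_majorant[of f] by metis
  obtain C where C: "\<And>N. (\<Sum>k<N. blinfun_apply h (y k) powr p) \<le> C"
    using disjoint_minorant_p_sums_bounded[OF p x pos disj dom h(1)] by blast
  show "summable (\<lambda>k. \<bar>blinfun_apply f (y k)\<bar> powr p)"
  proof (rule summableI_nonneg_bounded)
    fix N
    have "(\<Sum>k<N. \<bar>blinfun_apply f (y k)\<bar> powr p) \<le> (\<Sum>k<N. blinfun_apply h (y k) powr p)"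
      using p by (intro sum_mono powr_mono2 h pos) auto
    then show "(\<Sum>k<N. \<bar>blinfun_apply f (y k)\<bar> powr p) \<le> C" using C[of N] by simp
  qed simp
qed

section \<open>From the disjoint to the positive property\<close>

text \<open>Classical disjointification.  The subsequence \<open>m\<close> is chosen so sparse that \<open>F (m k)\<close> is
  small on \<open>4 ^ k\<close> times the sum \<open>S k\<close> of the previous terms, which is possible as
  \<open>F\<close> is weak* null.  With \<open>W = \<Sum> 2^(-k) v (m k)\<close> the elements
  \<open>y k = (v (m k) - 4^k S k - 2^(-k) W)\<^sup>+\<close> are disjoint, and from some \<open>k\<close> on
  the two subtracted terms cost \<open>F (m k)\<close> at most \<open>e / 4\<close> each.\<close>
lemma disjoint_minorants_exist:
  fixes v :: "nat \<Rightarrow> 'a::banach_lattice" and F :: "nat \<Rightarrow> 'a \<Rightarrow>\<^sub>L real"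
  assumes vpos: "\<And>n. 0 \<le> v n" and vbound: "\<And>n. norm (v n) \<le> B"
    and Fpos: "\<And>n. positive_functional (F n)" and F: "weak_star_null F"
    and e: "0 < e" and Fv: "\<And>n. e \<le> blinfun_apply (F n) (v n)"
  shows "\<exists>m y. strict_mono m \<and> (\<forall>k. 0 \<le> y k \<and> y k \<le> v (m k))
    \<and> (\<forall>i k. i \<noteq> k \<longrightarrow> inf (y i) (y k) = 0)
    \<and> (\<forall>\<^sub>F k in sequentially. e / 2 \<le> blinfun_apply (F (m k)) (y k))"
proof -
  define P where "P k ms \<longleftrightarrow> blinfun_apply (F (fst ms)) ((4 ^ k) *\<^sub>R snd ms) \<le> e / 4"
    for k and ms :: "nat \<times> 'a"
  define Q where "Q ms ms' \<longleftrightarrow> fst ms < fst ms' \<and> snd ms' = snd ms + v (fst ms)"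
    for ms ms' :: "nat \<times> 'a"
  have lim: "(\<lambda>n. blinfun_apply (F n) x) \<longlonglongrightarrow> 0" for x
    using F by (simp add: weak_star_null_def)
  \<comment> \<open>The recursion carries the pair of the index \<open>m k\<close> and the partial sum \<open>S k\<close>.\<close>
  obtain M where M0: "M 0 = (0, 0)" and M: "\<And>k. P k (M k)" "\<And>k. Q (M k) (M (Suc k))"
  proof -
    have "\<exists>M. \<forall>k. (P k (M k) \<and> (k = 0 \<longrightarrow> M k = (0, 0))) \<and> Q (M k) (M (Suc k))"
    proof (rule dependent_nat_choice)
      show "\<exists>ms. P 0 ms \<and> (0 = 0 \<longrightarrow> ms = (0, 0))"
        using e by (simp add: P_def blinfun.zero_right)
    next
      fix ms k
      have "\<forall>\<^sub>F n in sequentially. blinfun_apply (F n) ((4 ^ Suc k) *\<^sub>R (snd ms + v (fst ms))) < e / 4"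
        using e by (intro order_tendstoD(2)[OF lim]) simp
      moreover have "\<forall>\<^sub>F n in sequentially. fst ms < n" by (rule eventually_gt_at_top)
      ultimately have "\<forall>\<^sub>F n in sequentially. P (Suc k) (n, snd ms + v (fst ms))
          \<and> Q ms (n, snd ms + v (fst ms))"
        by eventually_elim (simp add: P_def Q_def)
      then have "\<exists>n. P (Suc k) (n, snd ms + v (fst ms)) \<and> Q ms (n, snd ms + v (fst ms))"
        by (rule eventually_happens'[OF sequentially_bot])
      then show "\<exists>ms'. (P (Suc k) ms' \<and> (Suc k = 0 \<longrightarrow> ms' = (0, 0))) \<and> Q ms ms'" by blast
    qed
    then show ?thesis using that by blast
  qed
  define m where "m k = fst (M k)" for k
  define S where "S k = snd (M k)" for k
  have m: "strict_mono m" using M(2) by (intro strict_monoI_Suc) (simp add: m_def Q_def)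
  have S: "S k = (\<Sum>i<k. v (m i))" for k
  proof (induction k)
    case (Suc k)
    then show ?case using M(2)[of k] by (simp add: S_def m_def Q_def)
  qed (simp add: S_def M0)
  have FS: "blinfun_apply (F (m k)) ((4 ^ k) *\<^sub>R S k) \<le> e / 4" for k
    using M(1)[of k] by (simp add: P_def m_def S_def)
  have S0: "0 \<le> S k" for k unfolding S by (intro sum_nonneg vpos)
  have vS: "v (m i) \<le> S k" if "i < k" for i k
  proof -
    have "S k = v (m i) + (\<Sum>j\<in>{..<k} - {i}. v (m j))"
      unfolding S using that by (intro sum.remove) auto
    moreover have "0 \<le> (\<Sum>j\<in>{..<k} - {i}. v (m j))" by (intro sum_nonneg vpos)
    ultimately show ?thesis by simp
  qed
  define W where "W = (\<Sum>k. (1/2) ^ k *\<^sub>R v (m k))"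
  have summable: "summable (\<lambda>k. (1/2) ^ k *\<^sub>R v (m k))"
  proof (rule summable_comparison_test')
    show "summable (\<lambda>k. (1/2) ^ k * B)" by (intro summable_mult2 summable_geometric) simp
    show "norm ((1/2) ^ k *\<^sub>R v (m k)) \<le> (1/2) ^ k * B" if "k \<ge> 0" for k
    proof -
      have "norm ((1/2) ^ k *\<^sub>R v (m k)) = (1/2) ^ k * norm (v (m k))" by simp
      also have "\<dots> \<le> (1/2) ^ k * B" by (intro mult_left_mono vbound) simp
      finally show ?thesis .
    qed
  qed
  have vW: "(1/2) ^ k *\<^sub>R v (m k) \<le> W" for k
    unfolding W_def by (intro suminf_term_le[OF summable] scaleR_nonneg_nonneg vpos) simp
  have "v (m 0) \<le> W" using vW[of 0] by simp
  with vpos have W0: "0 \<le> W" by (rule order_trans)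
  have v_le: "v (m k) \<le> (2 ^ k) *\<^sub>R W" for k
  proof -
    have "(2 ^ k) *\<^sub>R ((1/2) ^ k *\<^sub>R v (m k)) \<le> (2 ^ k) *\<^sub>R W"
      by (intro scaleR_left_mono vW) simp
    moreover have "(2::real) ^ k * (1/2) ^ k = 1" by (simp add: power_mult_distrib[symmetric])
    ultimately show ?thesis by (simp only: scaleR_scaleR scaleR_one)
  qed
  define y where "y k = pprt (v (m k) - (4 ^ k) *\<^sub>R S k - (1/2) ^ k *\<^sub>R W)" for k
  have y0: "0 \<le> y k" for k by (simp add: y_def)
  have term0: "0 \<le> (4 ^ k) *\<^sub>R S k" "0 \<le> (1/2) ^ k *\<^sub>R W" for k
    by (intro scaleR_nonneg_nonneg S0 W0; simp)+
  have y_le: "y k \<le> v (m k)" for k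
  proof -
    have "v (m k) - (4 ^ k) *\<^sub>R S k - (1/2) ^ k *\<^sub>R W \<le> v (m k) - 0 - 0"
      by (intro diff_mono term0 order_refl)
    then have "y k \<le> pprt (v (m k))" unfolding y_def diff_0_right by (rule pprt_mono)
    then show ?thesis using vpos by simp
  qed
  have disj: "inf (y i) (y k) = 0" if ik: "i < k" for i k
  proof -
    define a where "a = v (m i) - (1/2) ^ i *\<^sub>R W"
    have 1: "y i \<le> pprt a"
      unfolding y_def a_def
      using term0(1)[of i] by (intro pprt_mono diff_mono order_refl) (simp only: diff_le_eq le_add_same_cancel1)
    \<comment> \<open>As \<open>v (m k) \<le> 2^k W\<close> and \<open>2^k / 4^k \<le> 2^(-i)\<close>, the element \<open>y k\<close> lies below a multiple of the negative part of \<open>a\<close>.\<close>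
    have "v (m k) - (4 ^ k) *\<^sub>R S k - (1/2) ^ k *\<^sub>R W \<le> (2 ^ k) *\<^sub>R W - (4 ^ k) *\<^sub>R v (m i) - 0"
      by (intro diff_mono scaleR_left_mono v_le vS[OF ik] term0(2)) simp
    also have "\<dots> = (4 ^ k) *\<^sub>R ((1/2) ^ k *\<^sub>R W - v (m i))"
    proof -
      have "(4::real) ^ k * (1/2) ^ k = 2 ^ k" by (simp add: power_mult_distrib[symmetric])
      then show ?thesis by (simp only: scaleR_diff_right scaleR_scaleR diff_0_right)
    qed
    also have "\<dots> \<le> (4 ^ k) *\<^sub>R ((1/2) ^ i *\<^sub>R W - v (m i))"
      using ik by (intro scaleR_left_mono diff_mono scaleR_right_mono power_decreasing W0 order_refl) simp_all
    also have "(1/2) ^ i *\<^sub>R W - v (m i) = - a" by (simp only: a_def minus_diff_eq)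
    finally have "y k \<le> pprt ((4 ^ k) *\<^sub>R (- a))" unfolding y_def by (intro pprt_mono)
    also have "\<dots> = (4 ^ k) *\<^sub>R pprt (- a)" by (rule pprt_scaleR) simp
    finally have 2: "y k \<le> (4 ^ k) *\<^sub>R pprt (- a)" .
    have "inf (pprt (- a)) (pprt a) = 0" by (subst inf_commute) (rule inf_pprt_uminus_eq_0)
    then have "inf ((4 ^ k) *\<^sub>R pprt (- a)) (pprt a) = 0" by (intro inf_scaleR_eq_0 zero_le_pprt) simp_all
    then have "inf (y k) (y i) = 0" using y0[of k] 2 y0[of i] 1 by (rule inf_eq_0_mono)
    then show ?thesis by (simp only: inf_commute)
  qed
  have "(\<lambda>k. blinfun_apply (F (m k)) W) \<longlonglongrightarrow> 0"
    using LIMSEQ_subseq_LIMSEQ[OF lim m, of W] by (simp add: o_def)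
  then have "\<forall>\<^sub>F k in sequentially. blinfun_apply (F (m k)) W < e / 4"
    using e by (intro order_tendstoD(2)) auto
  then have ev: "\<forall>\<^sub>F k in sequentially. e / 2 \<le> blinfun_apply (F (m k)) (y k)"
  proof eventually_elim
    case (elim k)
    let ?F = "blinfun_apply (F (m k))"
    have "0 \<le> ?F W" using Fpos W0 by (simp add: positive_functional_def)
    then have "(1/2) ^ k * ?F W \<le> 1 * ?F W" by (intro mult_right_mono power_le_one) auto
    moreover have "?F (v (m k) - (4 ^ k) *\<^sub>R S k - (1/2) ^ k *\<^sub>R W) \<le> ?F (y k)"
      unfolding y_def by (intro positive_functional_mono[OF Fpos]) (simp add: pprt_def)
    ultimately show ?case
      using elim FS[of k] Fv[of "m k"] by (simp add: blinfun.diff_right blinfun.scaleR_right)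
  qed
  have "inf (y i) (y k) = 0" if "i \<noteq> k" for i k
    using that disj[of i k] disj[of k i] by (metis inf_commute nat_neq_iff)
  then show ?thesis using m y0 y_le ev by blast
qed

lemma weakly_p_summable_reindex:
  assumes "weakly_p_summable p x" "inj r"
  shows "weakly_p_summable p (\<lambda>j. x (r j))"
  unfolding weakly_p_summable_def
proof
  fix f
  have "summable (\<lambda>n. \<bar>blinfun_apply f (x n)\<bar> powr p)"
    using assms(1) by (simp add: weakly_p_summable_def)
  from summable_reindex[OF this assms(2)]
  show "summable (\<lambda>j. \<bar>blinfun_apply f (x (r j))\<bar> powr p)" by (simp add: o_def)
qed

lemma weak_star_null_subseq:
  assumes "weak_star_null f" "strict_mono r"
  shows "weak_star_null (\<lambda>j. f (r j))"
  unfolding weak_star_null_def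
proof
  fix x
  have "(\<lambda>n. blinfun_apply (f n) x) \<longlonglongrightarrow> 0" using assms(1) by (simp add: weak_star_null_def)
  from LIMSEQ_subseq_LIMSEQ[OF this assms(2)]
  show "(\<lambda>j. blinfun_apply (f (r j)) x) \<longlonglongrightarrow> 0" by (simp add: o_def)
qed

text \<open>Failure of uniform convergence to zero is witnessed along a subsequence by points of \<open>A\<close>.\<close>
lemma not_uniformly_null_subseq:
  fixes f :: "nat \<Rightarrow> 'a \<Rightarrow> real"
  assumes "\<not> uniform_limit A f (\<lambda>x. 0) sequentially"
  shows "\<exists>e (s :: nat \<Rightarrow> nat) X. 0 < e \<and> strict_mono s \<and> (\<forall>j. X j \<in> A \<and> e \<le> \<bar>f (s j) (X j)\<bar>)"
proof -
  obtain e where e: "0 < e" "\<not> (\<forall>\<^sub>F n in sequentially. \<forall>x\<in>A. \<bar>f n x\<bar> < e)"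
    using assms by (auto simp: uniform_limit_iff dist_real_def)
  obtain s :: "nat \<Rightarrow> nat" where s: "strict_mono s \<and> (\<forall>j. \<not> (\<forall>x\<in>A. \<bar>f (s j) x\<bar> < e))"
    using not_eventually_sequentiallyD[OF e(2)] by (rule exE)
  then have "\<forall>j. \<exists>x. x \<in> A \<and> e \<le> \<bar>f (s j) x\<bar>" by (meson not_le)
  then obtain X where "\<forall>j. X j \<in> A \<and> e \<le> \<bar>f (s j) (X j)\<bar>" by metis
  then show ?thesis using e(1) s by blast
qed

lemma uniformly_null_diagonal:
  fixes f :: "nat \<Rightarrow> 'a \<Rightarrow> real"
  assumes "uniform_limit A f (\<lambda>x. 0) sequentially" "\<And>n. X n \<in> A"
  shows "(\<lambda>n. f n (X n)) \<longlonglongrightarrow> 0"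
proof (rule tendstoI)
  fix e :: real assume "0 < e"
  then have "\<forall>\<^sub>F n in sequentially. \<forall>x\<in>A. dist (f n x) 0 < e"
    using assms(1) by (simp add: uniform_limit_iff)
  then show "\<forall>\<^sub>F n in sequentially. dist (f n (X n)) 0 < e"
    by eventually_elim (use assms(2) in blast)
qed

lemma positive_functional_abs_le:
  assumes "positive_functional f"
  shows "\<bar>blinfun_apply f x\<bar> \<le> blinfun_apply f \<bar>x\<bar>"
proof -
  have "blinfun_apply f x \<le> blinfun_apply f \<bar>x\<bar>"
    by (intro positive_functional_mono assms abs_ge_self)
  moreover have "blinfun_apply f (- x) \<le> blinfun_apply f \<bar>x\<bar>"
    by (intro positive_functional_mono assms abs_ge_minus_self)
  ultimately show ?thesis by (simp add: blinfun.minus_right abs_le_iff)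
qed

text \<open>A weakly \<open>p\<close>-summable sequence is norm bounded, so its moduli admit disjoint minorants on
  which a subsequence of \<open>F\<close> stays large.  These minorants are weakly \<open>p\<close>-summable, hence form a
  limited set, on which \<open>F\<close> tends to zero uniformly.\<close>
lemma disjoint_DP_star_no_uniform_gap:
  fixes w :: "nat \<Rightarrow> 'a::banach_lattice"
  assumes p: "1 \<le> p" and DP: "disjoint_DP_star TYPE('a) p"
    and w: "weakly_p_summable p w"
    and Fpos: "\<And>n. positive_functional (F n)" and F: "weak_star_null F"
    and e: "0 < e" and Fw: "\<And>n. e \<le> \<bar>blinfun_apply (F n) (w n)\<bar>"
  shows False
proof -
  obtain B where B: "\<And>k. norm (w k) \<le> B" using weakly_p_summable_norm_bounded[OF p w] by blast
  have "norm \<bar>w k\<bar> \<le> B" for k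
    using B[of k] norm_mono_abs[of "\<bar>w k\<bar>" "w k"] by simp
  moreover have "e \<le> blinfun_apply (F k) \<bar>w k\<bar>" for k
    using Fw[of k] positive_functional_abs_le[OF Fpos] by (rule order_trans)
  ultimately have "\<exists>m y. strict_mono m \<and> (\<forall>k. 0 \<le> y k \<and> y k \<le> \<bar>w (m k)\<bar>)
    \<and> (\<forall>i k. i \<noteq> k \<longrightarrow> inf (y i) (y k) = 0)
    \<and> (\<forall>\<^sub>F k in sequentially. e / 2 \<le> blinfun_apply (F (m k)) (y k))"
    by (intro disjoint_minorants_exist[where B = B] abs_ge_zero Fpos F e)
  then obtain m y where m: "strict_mono m"
    and y: "\<And>k. 0 \<le> y k" "\<And>k. y k \<le> \<bar>w (m k)\<bar>" "\<And>i k. i \<noteq> k \<Longrightarrow> inf (y i) (y k) = 0"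
    and Fy: "\<forall>\<^sub>F k in sequentially. e / 2 \<le> blinfun_apply (F (m k)) (y k)"
    by blast
  have "weakly_p_summable p (\<lambda>k. w (m k))"
    by (rule weakly_p_summable_reindex[OF w strict_mono_imp_inj_on[OF m]])
  then have "weakly_p_summable p y"
    by (rule weakly_p_summable_disjoint_minorant[OF p _ y(1) y(3) y(2)])
  moreover have "disjoint_seq y" using y by (simp add: disjoint_seq_def)
  ultimately have "limited_set (range y)" using DP by (auto simp: disjoint_DP_star_def)
  then have "uniform_limit (range y) (\<lambda>k. blinfun_apply (F (m k))) (\<lambda>x. 0) sequentially"
    using weak_star_null_subseq[OF F m] by (auto simp: limited_set_def)
  then have "(\<lambda>k. blinfun_apply (F (m k)) (y k)) \<longlonglongrightarrow> 0"
    by (rule uniformly_null_diagonal) simp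
  then have "\<forall>\<^sub>F k in sequentially. blinfun_apply (F (m k)) (y k) < e / 2"
    using e by (intro order_tendstoD(2)) auto
  with Fy have "\<forall>\<^sub>F k :: nat in sequentially. False" by eventually_elim simp
  then show False by simp
qed

lemma disjoint_DP_star_imp_positive_DP_star:
  assumes p: "1 \<le> p" and DP: "disjoint_DP_star TYPE('a::banach_lattice) p"
  shows "positive_DP_star TYPE('a) p"
  unfolding positive_DP_star_def positively_limited_set_def
proof (intro allI impI conjI)
  fix A :: "'a set" assume A: "relatively_weakly_p_compact p A"
  show "bounded A"
  proof (rule ccontr)
    assume "\<not> bounded A"
    then have "\<forall>n. \<exists>x. x \<in> A \<and> real n < norm x" by (meson bounded_iff not_le)
    then obtain X where X: "\<And>n. X n \<in> A" "\<And>n. real n < norm (X n)" by metis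
    obtain r l where r: "strict_mono r" "weakly_p_summable p (\<lambda>j. X (r j) - l)"
      using A X(1) unfolding relatively_weakly_p_compact_def by blast
    obtain B where B: "\<And>j. norm (X (r j) - l) \<le> B"
      using weakly_p_summable_norm_bounded[OF p r(2)] by blast
    obtain j :: nat where j: "B + norm l \<le> real j" using real_arch_simple by blast
    have "real j \<le> real (r j)" using seq_suble[OF r(1)] by simp
    also have "\<dots> < norm (X (r j))" by (rule X)
    also have "\<dots> \<le> norm (X (r j) - l) + norm l" by (metis diff_add_cancel norm_triangle_ineq)
    also have "\<dots> \<le> real j" using B[of j] j by simp
    finally show False by simp
  qed
  fix f :: "nat \<Rightarrow> 'a \<Rightarrow>\<^sub>L real"
  assume f: "weak_star_null f \<and> (\<forall>n. positive_functional (f n))"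
  show "uniform_limit A (\<lambda>n. blinfun_apply (f n)) (\<lambda>x. 0) sequentially"
  proof (rule ccontr)
    assume not: "\<not> uniform_limit A (\<lambda>n. blinfun_apply (f n)) (\<lambda>x. 0) sequentially"
    obtain e X and s :: "nat \<Rightarrow> nat" where e: "0 < e" and s: "strict_mono s" and X: "\<And>j. X j \<in> A"
      and fX: "\<And>j. e \<le> \<bar>blinfun_apply (f (s j)) (X j)\<bar>"
      using not_uniformly_null_subseq[OF not] by blast
    obtain r l where r: "strict_mono r" and w: "weakly_p_summable p (\<lambda>j. X (r j) - l)"
      using A X unfolding relatively_weakly_p_compact_def by blast
    have F: "weak_star_null (\<lambda>j. f (s (r j)))"
      using weak_star_null_subseq[OF weak_star_null_subseq[OF conjunct1[OF f] s] r] .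
    then have "(\<lambda>j. blinfun_apply (f (s (r j))) l) \<longlonglongrightarrow> 0" by (simp add: weak_star_null_def)
    then have "\<forall>\<^sub>F j in sequentially. dist (blinfun_apply (f (s (r j))) l) 0 < e / 2"
      using e by (intro tendstoD) auto
    then obtain J where J: "\<And>j. j \<ge> J \<Longrightarrow> \<bar>blinfun_apply (f (s (r j))) l\<bar> < e / 2"
      by (auto simp: eventually_sequentially)
    \<comment> \<open>Dropping the first \<open>J\<close> terms makes the gap hold for all indices.\<close>
    have shift: "strict_mono (\<lambda>j. j + J)" by (simp add: strict_mono_def)
    show False
    proof (rule disjoint_DP_star_no_uniform_gap[OF p DP])
      show "weakly_p_summable p (\<lambda>j. X (r (j + J)) - l)"
        using weakly_p_summable_reindex[OF w strict_mono_imp_inj_on[OF shift]] .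
      show "weak_star_null (\<lambda>j. f (s (r (j + J))))" using weak_star_null_subseq[OF F shift] .
      show "positive_functional (f (s (r (j + J))))" for j using f by blast
      show "0 < e / 2" using e by simp
      show "e / 2 \<le> \<bar>blinfun_apply (f (s (r (j + J)))) (X (r (j + J)) - l)\<bar>" for j
        using fX[of "r (j + J)"] J[of "j + J"] unfolding blinfun.diff_right by linarith
    qed
  qed
qed

section \<open>Weak* null sequences on order bounded disjoint sequences\<close>

lemma infinite_partition:
  fixes I :: "nat set"
  assumes "infinite I"
  shows "\<exists>J :: nat \<Rightarrow> nat set. (\<forall>i. infinite (J i) \<and> J i \<subseteq> I) \<and> (\<forall>i k. i \<noteq> k \<longrightarrow> J i \<inter> J k = {})"
proof -
  define g where "g = (\<lambda>ik. enumerate I (prod_encode ik))"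
  have inj: "inj g"
  proof (rule injI)
    fix a b assume "g a = g b"
    then have "prod_encode a = prod_encode b"
      unfolding g_def by (rule injD[OF strict_mono_imp_inj_on[OF strict_mono_enumerate[OF assms]]])
    then show "a = b" by simp
  qed
  define J where "J i = range (\<lambda>k. g (i, k))" for i
  have "infinite (J i)" for i
    unfolding J_def
  proof (rule range_inj_infinite, rule injI)
    fix a b assume "g (i, a) = g (i, b)"
    then show "a = b" using injD[OF inj] by blast
  qed
  moreover have "J i \<subseteq> I" for i
    unfolding J_def g_def by (intro image_subsetI enumerate_in_set assms)
  moreover have "J i \<inter> J k = {}" if "i \<noteq> k" for i k
  proof -
    have "g (i, a) \<noteq> g (k, b)" for a b using injD[OF inj, of "(i, a)" "(k, b)"] that by blast
    then show ?thesis unfolding J_def by blast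
  qed
  ultimately show ?thesis by blast
qed

text \<open>Rosenthal's lemma for finitely superadditive set functions.  Split the index set into infinitely
  many infinite sets \<open>J i\<close>.  If none of them works, each contains some \<open>c i\<close> with
  \<open>\<mu> (c i) (J i - {c i}) \<ge> e\<close>.  The set of all \<open>c i\<close> avoids
  \<open>J i - {c i}\<close>, so passing to it lowers the total mass by \<open>e\<close>, and this can happen only
  finitely often.\<close>
lemma rosenthal_finitely_additive:
  fixes \<mu> :: "nat \<Rightarrow> nat set \<Rightarrow> real"
  assumes nonneg: "\<And>n A. 0 \<le> \<mu> n A"
    and super: "\<And>n A B. A \<inter> B = {} \<Longrightarrow> \<mu> n A + \<mu> n B \<le> \<mu> n (A \<union> B)"
    and bound: "\<And>n A. \<mu> n A \<le> C"
    and e: "0 < e" and I: "infinite I"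
  shows "\<exists>M\<subseteq>I. infinite M \<and> (\<forall>n\<in>M. \<mu> n (M - {n}) < e)"
proof -
  have mono: "\<mu> n A \<le> \<mu> n B" if "A \<subseteq> B" for n A B
  proof -
    have "\<mu> n A + \<mu> n (B - A) \<le> \<mu> n (A \<union> (B - A))" by (rule super) blast
    moreover have "A \<union> (B - A) = B" using that by blast
    ultimately show ?thesis using nonneg[of n "B - A"] by simp
  qed
  \<comment> \<open>Induction on a bound for the total mass, measured in multiples of \<open>e\<close>.\<close>
  have "\<exists>M\<subseteq>I. infinite M \<and> (\<forall>n\<in>M. \<mu> n (M - {n}) < e)"
    if "infinite I" "\<forall>n\<in>I. \<mu> n I \<le> real j * e" for j I
    using that
  proof (induction j arbitrary: I)
    case 0
    have "\<mu> n (I - {n}) < e" if "n \<in> I" for n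
    proof -
      have "\<mu> n (I - {n}) \<le> \<mu> n I" by (rule mono) blast
      also have "\<dots> \<le> 0" using 0 that by simp
      finally show ?thesis using e by simp
    qed
    then show ?case using 0 by blast
  next
    case (Suc j)
    obtain J :: "nat \<Rightarrow> nat set" where J: "\<And>i. infinite (J i)" "\<And>i. J i \<subseteq> I" "\<And>i k. i \<noteq> k \<Longrightarrow> J i \<inter> J k = {}"
      using infinite_partition[OF Suc.prems(1)] by blast
    show ?case
    proof (cases "\<exists>i. \<forall>n\<in>J i. \<mu> n (J i - {n}) < e")
      case True
      then show ?thesis using J by blast
    next
      case False
      then have "\<forall>i. \<exists>n. n \<in> J i \<and> e \<le> \<mu> n (J i - {n})" by (meson not_le)
      then obtain c where c: "\<And>i. c i \<in> J i" "\<And>i. e \<le> \<mu> (c i) (J i - {c i})" by metis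
      have "inj c"
      proof (rule injI)
        fix i k assume "c i = c k"
        then have "c i \<in> J i \<inter> J k" using c(1)[of i] c(1)[of k] by simp
        then show "i = k" using J(3) by blast
      qed
      then have inf: "infinite (range c)" by (rule range_inj_infinite)
      have sub: "range c \<subseteq> I" using c(1) J(2) by blast
      have "\<mu> (c i) (range c) \<le> real j * e" for i
      proof -
        have "range c \<inter> (J i - {c i}) = {}"
        proof -
          have "c k \<notin> J i" if "c k \<noteq> c i" for k
            using J(3)[of k i] c(1)[of k] that by (cases "k = i") auto
          then show ?thesis by blast
        qed
        then have "\<mu> (c i) (range c) + \<mu> (c i) (J i - {c i}) \<le> \<mu> (c i) (range c \<union> (J i - {c i}))"
          by (rule super)
        also have "\<dots> \<le> \<mu> (c i) I" using sub J(2) by (intro mono) blast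
        also have "\<dots> \<le> real (Suc j) * e" using Suc.prems(2) c(1) J(2) by blast
        finally show ?thesis using c(2)[of i] by (simp add: distrib_right)
      qed
      then have "\<exists>M\<subseteq>range c. infinite M \<and> (\<forall>n\<in>M. \<mu> n (M - {n}) < e)"
        by (intro Suc.IH inf) blast
      then obtain M where M: "M \<subseteq> range c" "infinite M" "\<forall>n\<in>M. \<mu> n (M - {n}) < e" by blast
      have "M \<subseteq> I" using M(1) sub by (rule subset_trans)
      then show ?thesis using M(2,3) by blast
    qed
  qed
  moreover obtain j :: nat where "C / e \<le> real j" using real_arch_simple by blast
  then have "C \<le> real j * e" using e by (simp add: field_simps)
  then have "\<forall>n\<in>I. \<mu> n I \<le> real j * e" using order_trans[OF bound] by blast
  ultimately show ?thesis using I by blast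
qed

text \<open>Disjointness from each \<open>z k\<close> passes to their supremum, because \<open>z k + b = sup (z k) b\<close>
  bounds \<open>z k\<close> by \<open>sup w b - b\<close>.\<close>
lemma inf_least_upper_bound_eq_0:
  fixes z :: "nat \<Rightarrow> 'a::lattice_ab_group_add"
  assumes w: "0 \<le> w" "\<And>b. 0 \<le> b \<Longrightarrow> (\<And>k. k \<in> A \<Longrightarrow> z k \<le> b) \<Longrightarrow> w \<le> b"
    and b: "0 \<le> b" and le: "\<And>k. k \<in> A \<Longrightarrow> z k \<le> w" and disj: "\<And>k. k \<in> A \<Longrightarrow> inf (z k) b = 0"
  shows "inf w b = 0"
proof (rule antisym)
  have "w \<le> sup w b - b"
  proof (rule w(2))
    show "0 \<le> sup w b - b" by (simp only: diff_ge_0_iff_ge sup_ge2)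
    fix k assume k: "k \<in> A"
    have "z k + b = sup (z k) b" using add_eq_inf_sup[of "z k" b] disj[OF k] by simp
    also have "\<dots> \<le> sup w b" by (intro sup_mono le k order_refl)
    finally show "z k \<le> sup w b - b" by (simp only: le_diff_eq)
  qed
  then have "w + b \<le> sup w b" by (simp only: le_diff_eq)
  then show "inf w b \<le> 0" unfolding add_eq_inf_sup[of w b] by (simp only: add_le_same_cancel1)
qed (intro inf_greatest w b)

text \<open>By countable order completeness the supremum \<open>w A\<close> of the \<open>z k\<close> with \<open>k \<in> A\<close>
  exists for every set \<open>A\<close>, and \<open>w\<close> is finitely additive since the \<open>z k\<close> are disjoint.
  Let \<open>h n\<close> be a positive majorant of \<open>f n\<close>.  If \<open>\<bar>f n (z n)\<bar> \<ge> e\<close> for infinitely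
  many \<open>n\<close>, Rosenthal's lemma for the set functions \<open>h n \<circ> w\<close> gives an infinite set
  \<open>M\<close> of such \<open>n\<close> for which \<open>f n\<close> is small on \<open>w (M - {n})\<close>.  Then
  \<open>f n (w M)\<close> stays away from zero for \<open>n \<in> M\<close>, and \<open>f\<close> is not weak* null at the single
  point \<open>w M\<close>.\<close>
lemma order_bounded_disjoint_null:
  fixes z :: "nat \<Rightarrow> 'a::banach_lattice" and f :: "nat \<Rightarrow> 'a \<Rightarrow>\<^sub>L real"
  assumes dc: "sigma_dedekind_complete TYPE('a)" and f: "weak_star_null f"
    and z0: "\<And>n. 0 \<le> z n" and zy: "\<And>n. z n \<le> y" and disj: "\<And>i k. i \<noteq> k \<Longrightarrow> inf (z i) (z k) = 0"
  shows "(\<lambda>n. blinfun_apply (f n) (z n)) \<longlonglongrightarrow> 0"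
proof -
  have y0: "0 \<le> y" using z0[of 0] zy[of 0] by (rule order_trans)
  \<comment> \<open>Adjoining \<open>0\<close> gives the empty family the supremum \<open>0\<close>.\<close>
  have "\<exists>s. 0 \<le> s \<and> (\<forall>k\<in>A. z k \<le> s) \<and> (\<forall>b. 0 \<le> b \<and> (\<forall>k\<in>A. z k \<le> b) \<longrightarrow> s \<le> b)" for A :: "nat set"
  proof -
    have "countable (insert 0 (z ` A))" "insert 0 (z ` A) \<noteq> {}" by auto
    moreover have "bdd_above (insert 0 (z ` A))" using y0 zy by (intro bdd_aboveI[of _ y]) blast
    ultimately obtain s where s: "\<forall>a\<in>insert 0 (z ` A). a \<le> s"
      "\<And>b. \<forall>a\<in>insert 0 (z ` A). a \<le> b \<Longrightarrow> s \<le> b"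
      using dc unfolding sigma_dedekind_complete_def by blast
    have "s \<le> b" if "0 \<le> b \<and> (\<forall>k\<in>A. z k \<le> b)" for b
      using that by (intro s(2)) simp
    moreover have "0 \<le> s \<and> (\<forall>k\<in>A. z k \<le> s)" using s(1) by simp
    ultimately show ?thesis by blast
  qed
  then have "\<exists>w. \<forall>A. 0 \<le> w A \<and> (\<forall>k\<in>A. z k \<le> w A)
      \<and> (\<forall>b. 0 \<le> b \<and> (\<forall>k\<in>A. z k \<le> b) \<longrightarrow> w A \<le> b)"
    by (intro choice allI)
  then obtain w where w: "\<forall>A. 0 \<le> w A \<and> (\<forall>k\<in>A. z k \<le> w A)
      \<and> (\<forall>b. 0 \<le> b \<and> (\<forall>k\<in>A. z k \<le> b) \<longrightarrow> w A \<le> b)" ..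
  have w0: "0 \<le> w A" for A using w by blast
  have zw: "z k \<le> w A" if "k \<in> A" for A k using w that by blast
  have least: "w A \<le> b" if "0 \<le> b" "\<And>k. k \<in> A \<Longrightarrow> z k \<le> b" for A b
    using spec[OF w, of A] that by simp
  have wy: "w A \<le> y" for A by (intro least y0 zy)
  have w_single: "w {n} = z n" for n
    by (intro antisym least z0 zw) simp_all
  have w_disj: "inf (w A) (w B) = 0" if AB: "A \<inter> B = {}" for A B
  proof (rule inf_least_upper_bound_eq_0[of "w A" A z])
    fix k assume k: "k \<in> A"
    have "inf (w B) (z k) = 0"
    proof (rule inf_least_upper_bound_eq_0[of "w B" B z])
      show "inf (z i) (z k) = 0" if "i \<in> B" for i using that k AB by (intro disj) blast
    qed (use w0 least z0 zw in blast)+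
    then show "inf (z k) (w B) = 0" by (simp only: inf_commute)
  qed (use w0 least zw in blast)+
  have w_Un: "w (A \<union> B) = w A + w B" if AB: "A \<inter> B = {}" for A B
  proof (rule antisym)
    show "w (A \<union> B) \<le> w A + w B"
    proof (rule least)
      show "0 \<le> w A + w B" by (intro add_nonneg_nonneg w0)
      fix k assume "k \<in> A \<union> B"
      then show "z k \<le> w A + w B"
      proof
        assume "k \<in> A"
        then show ?thesis using add_mono[OF zw w0] by simp
      next
        assume "k \<in> B"
        then show ?thesis using add_mono[OF w0 zw] by simp
      qed
    qed
    have "w A + w B = sup (w A) (w B)"
      using add_eq_inf_sup[of "w A" "w B"] w_disj[OF AB] by simp
    also have "\<dots> \<le> w (A \<union> B)" by (intro sup_least least w0 zw) simp_all
    finally show "w A + w B \<le> w (A \<union> B)" .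
  qed
  obtain K where K: "\<And>n. norm (f n) \<le> K" using weak_star_null_norm_bounded[OF f] by blast
  have "\<forall>n. \<exists>h. positive_functional h \<and> norm h \<le> 5 * norm (f n)
      \<and> (\<forall>y\<ge>0. \<bar>blinfun_apply (f n) y\<bar> \<le> blinfun_apply h y)"
    by (metis positive_majorant)
  then obtain h where h: "\<And>n. positive_functional (h n)" "\<And>n. norm (h n) \<le> 5 * norm (f n)"
    "\<And>n y. 0 \<le> y \<Longrightarrow> \<bar>blinfun_apply (f n) y\<bar> \<le> blinfun_apply (h n) y"
    by metis
  show ?thesis
  proof (rule ccontr)
    assume "\<not> (\<lambda>n. blinfun_apply (f n) (z n)) \<longlonglongrightarrow> 0"
    then obtain e where e: "0 < e" and ev: "\<not> (\<forall>\<^sub>F n in sequentially. \<bar>blinfun_apply (f n) (z n)\<bar> < e)"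
      by (auto simp: tendsto_iff dist_real_def)
    define I where "I = {n. e \<le> \<bar>blinfun_apply (f n) (z n)\<bar>}"
    have "infinite I"
      unfolding I_def infinite_nat_iff_unbounded_le using ev by (auto simp: eventually_sequentially not_less)
    have "\<exists>M\<subseteq>I. infinite M \<and> (\<forall>n\<in>M. blinfun_apply (h n) (w (M - {n})) < e / 2)"
    proof (rule rosenthal_finitely_additive[where C = "5 * K * norm y"])
      show "0 \<le> blinfun_apply (h n) (w A)" for n A
        using h(1) w0 by (simp add: positive_functional_def)
      show "blinfun_apply (h n) (w A) + blinfun_apply (h n) (w B) \<le> blinfun_apply (h n) (w (A \<union> B))"
        if "A \<inter> B = {}" for n A B
        by (simp only: w_Un[OF that] blinfun.add_right order_refl)
      show "blinfun_apply (h n) (w A) \<le> 5 * K * norm y" for n A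
      proof -
        have "blinfun_apply (h n) (w A) \<le> norm (h n) * norm (w A)"
          using norm_blinfun[of "h n" "w A"] by simp
        also have "\<dots> \<le> (5 * K) * norm y"
        proof (rule mult_mono)
          show hK: "norm (h n) \<le> 5 * K" using h(2)[of n] K[of n] by simp
          show "0 \<le> 5 * K" using norm_ge_zero hK by (rule order_trans)
          show "norm (w A) \<le> norm y" by (rule norm_mono_pos[OF w0 wy])
        qed simp
        finally show ?thesis .
      qed
      show "0 < e / 2" using e by simp
    qed (rule \<open>infinite I\<close>)
    then obtain M where M: "M \<subseteq> I" "infinite M"
      "\<And>n. n \<in> M \<Longrightarrow> blinfun_apply (h n) (w (M - {n})) < e / 2" by blast
    have "(\<lambda>n. blinfun_apply (f n) (w M)) \<longlonglongrightarrow> 0" using f by (simp add: weak_star_null_def)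
    then have "\<forall>\<^sub>F n in sequentially. dist (blinfun_apply (f n) (w M)) 0 < e / 2"
      using e by (intro tendstoD) auto
    then obtain N where N: "\<And>n. n \<ge> N \<Longrightarrow> \<bar>blinfun_apply (f n) (w M)\<bar> < e / 2"
      by (auto simp: eventually_sequentially)
    obtain n where n: "n \<in> M" "N \<le> n" using M(2) by (auto simp: infinite_nat_iff_unbounded_le)
    have "w M = z n + w (M - {n})"
      using w_Un[of "{n}" "M - {n}"] n(1) by (simp add: w_single insert_absorb)
    then have "blinfun_apply (f n) (w M) = blinfun_apply (f n) (z n) + blinfun_apply (f n) (w (M - {n}))"
      by (simp only: blinfun.add_right)
    moreover have "\<bar>blinfun_apply (f n) (w (M - {n}))\<bar> < e / 2"
      using h(3)[OF w0] M(3)[OF n(1)] by (rule order_le_less_trans)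
    moreover have "e \<le> \<bar>blinfun_apply (f n) (z n)\<bar>" using n(1) M(1) by (auto simp: I_def)
    ultimately show False using N[OF n(2)] by linarith
  qed
qed

text \<open>Take for \<open>g n\<close> the component of the positive part of \<open>f n\<close> on the band generated by
  \<open>u n\<close>; that band is the disjoint complement of the set \<open>D n\<close> of positive elements disjoint
  from \<open>u n\<close>.  The supremum defining \<open>g n y\<close> is nearly attained at some \<open>z n \<le> y\<close> in
  this band, and the \<open>z n\<close> are disjoint since the bands are.  Hence \<open>f n (z n)\<close> tends to zero,
  and so does \<open>g n y\<close>.\<close>
lemma positive_weak_star_null_majorant:
  fixes u :: "nat \<Rightarrow> 'a::banach_lattice" and f :: "nat \<Rightarrow> 'a \<Rightarrow>\<^sub>L real"
  assumes dc: "sigma_dedekind_complete TYPE('a)" and f: "weak_star_null f"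
    and u0: "\<And>n. 0 \<le> u n" and disj: "\<And>i k. i \<noteq> k \<Longrightarrow> inf (u i) (u k) = 0"
  shows "\<exists>g. weak_star_null g \<and> (\<forall>n. positive_functional (g n)
    \<and> blinfun_apply (f n) (u n) \<le> blinfun_apply (g n) (u n))"
proof -
  define D where "D n = {v. 0 \<le> v \<and> inf v (u n) = 0}" for n
  have "\<forall>n. \<exists>g. positive_functional g
    \<and> (\<forall>y. \<forall>z\<in>orthogonal_interval (D n) y. blinfun_apply (f n) z \<le> blinfun_apply g y)
    \<and> (\<forall>y\<ge>0. \<forall>e>0. \<exists>z\<in>orthogonal_interval (D n) y. blinfun_apply g y < blinfun_apply (f n) z + e)"
  proof
    fix n
    have "\<forall>v\<in>D n. 0 \<le> v" by (simp add: D_def)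
    from disjoint_component_functional[OF this, of "f n"]
    show "\<exists>g. positive_functional g
      \<and> (\<forall>y. \<forall>z\<in>orthogonal_interval (D n) y. blinfun_apply (f n) z \<le> blinfun_apply g y)
      \<and> (\<forall>y\<ge>0. \<forall>e>0. \<exists>z\<in>orthogonal_interval (D n) y. blinfun_apply g y < blinfun_apply (f n) z + e)"
      by blast
  qed
  then obtain g where g: "\<And>n. positive_functional (g n)"
    "\<And>n y z. z \<in> orthogonal_interval (D n) y \<Longrightarrow> blinfun_apply (f n) z \<le> blinfun_apply (g n) y"
    "\<And>n y e. 0 \<le> y \<Longrightarrow> 0 < e \<Longrightarrow> \<exists>z\<in>orthogonal_interval (D n) y. blinfun_apply (g n) y < blinfun_apply (f n) z + e"
    by metis
  have lim_pos: "(\<lambda>n. blinfun_apply (g n) y) \<longlonglongrightarrow> 0" if y: "0 \<le> y" for y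
  proof -
    have "\<forall>n. \<exists>z. z \<in> orthogonal_interval (D n) y \<and> blinfun_apply (g n) y < blinfun_apply (f n) z + inverse (real (Suc n))"
      using g(3)[OF y] by (metis inverse_positive_iff_positive of_nat_0_less_iff zero_less_Suc)
    then obtain z where z: "\<And>n. z n \<in> orthogonal_interval (D n) y"
      "\<And>n. blinfun_apply (g n) y < blinfun_apply (f n) (z n) + inverse (real (Suc n))" by metis
    have z': "0 \<le> z n" "z n \<le> y" "v \<in> D n \<Longrightarrow> inf (z n) v = 0" for n v
      using z(1)[of n] by (auto simp: orthogonal_interval_def)
    have z_disj: "inf (z i) (z k) = 0" if "i \<noteq> k" for i k
    proof (rule z'(3))
      have "u i \<in> D k" using u0 disj[OF that] by (simp add: D_def)
      then have "inf (z k) (u i) = 0" by (rule z'(3))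
      then show "z k \<in> D i" using z'(1) by (simp add: D_def)
    qed
    have "(\<lambda>n. blinfun_apply (f n) (z n)) \<longlonglongrightarrow> 0"
      by (rule order_bounded_disjoint_null[OF dc f z'(1) z'(2) z_disj])
    then have "(\<lambda>n. blinfun_apply (f n) (z n) + inverse (real (Suc n))) \<longlonglongrightarrow> 0 + 0"
      by (intro tendsto_add LIMSEQ_inverse_real_of_nat)
    then have *: "(\<lambda>n. blinfun_apply (f n) (z n) + inverse (real (Suc n))) \<longlonglongrightarrow> 0" by simp
    show ?thesis
    proof (rule tendsto_sandwich[OF _ _ tendsto_const *])
      show "\<forall>\<^sub>F n in sequentially. 0 \<le> blinfun_apply (g n) y"
        using g(1) y by (simp add: positive_functional_def)
      show "\<forall>\<^sub>F n in sequentially. blinfun_apply (g n) y \<le> blinfun_apply (f n) (z n) + inverse (real (Suc n))"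
        using z(2) by (intro always_eventually allI less_imp_le)
    qed
  qed
  have "(\<lambda>n. blinfun_apply (g n) x) \<longlonglongrightarrow> 0" for x
  proof -
    have "(\<lambda>n. blinfun_apply (g n) (pprt x) - blinfun_apply (g n) (pprt (- x))) \<longlonglongrightarrow> 0 - 0"
      by (intro tendsto_diff lim_pos zero_le_pprt)
    then show ?thesis by (simp only: blinfun.diff_right[symmetric] pprt_diff diff_0_right)
  qed
  moreover have "blinfun_apply (f n) (u n) \<le> blinfun_apply (g n) (u n)" for n
  proof (rule g(2))
    show "u n \<in> orthogonal_interval (D n) (u n)"
      using u0 by (auto simp: orthogonal_interval_def D_def inf_commute)
  qed
  ultimately show ?thesis using g(1) unfolding weak_star_null_def by blast
qed

section \<open>From the positive to the disjoint property\<close>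

text \<open>Sequences in \<open>range x\<close> are described by index sequences; after passing to a subsequence these
  are constant or strictly increasing.\<close>
lemma subseq_const_or_strict_mono:
  fixes c :: "nat \<Rightarrow> nat"
  obtains (const) r :: "nat \<Rightarrow> nat" and v where "strict_mono r" "\<And>j. c (r j) = v"
  | (strict) r :: "nat \<Rightarrow> nat" where "strict_mono r" "strict_mono (\<lambda>j. c (r j))"
proof (cases "finite (range c)")
  case True
  then obtain v where "infinite (c -` {v})"
    using inf_img_fin_dom[of c UNIV] by (auto simp: vimage_def)
  then obtain r :: "nat \<Rightarrow> nat" where "strict_mono r" "\<And>j. r j \<in> c -` {v}"
    using infinite_enumerate by blast
  then show ?thesis using that(1)[of r v] by simp
next
  case False
  have "\<exists>r :: nat \<Rightarrow> nat. \<forall>j. True \<and> (r j < r (Suc j) \<and> c (r j) < c (r (Suc j)))"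
  proof (rule dependent_nat_choice)
    fix n j :: nat
    have "infinite (range c - c ` {..n} - {..c n})" using False by simp
    then obtain a where "a \<in> range c - c ` {..n} - {..c n}" by (metis ex_in_conv finite.emptyI)
    then obtain m where "c m \<notin> c ` {..n}" "c n < c m" by auto
    then have "n < m \<and> c n < c m" by (metis atMost_iff image_eqI not_le)
    then show "\<exists>m. True \<and> (n < m \<and> c n < c m)" by blast
  qed simp
  then obtain r :: "nat \<Rightarrow> nat" where "\<And>j. r j < r (Suc j)" "\<And>j. c (r j) < c (r (Suc j))" by blast
  then show ?thesis using that(2)[of r] by (simp add: strict_mono_Suc_iff)
qed

lemma weakly_p_summable_0: "weakly_p_summable p (\<lambda>_. 0)"
  by (simp add: weakly_p_summable_def blinfun.zero_right)

lemma relatively_weakly_p_compact_range: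
  assumes "weakly_p_summable p u"
  shows "relatively_weakly_p_compact p (range u)"
  unfolding relatively_weakly_p_compact_def
proof (intro allI impI)
  fix X :: "nat \<Rightarrow> 'a" assume "\<forall>n. X n \<in> range u"
  then have "\<forall>n. \<exists>k. X n = u k" by blast
  then obtain c where c: "\<And>n. X n = u (c n)" by metis
  show "\<exists>r l. strict_mono r \<and> weakly_p_summable p (\<lambda>j. X (r j) - l)"
  proof (rule subseq_const_or_strict_mono[of c])
    fix r :: "nat \<Rightarrow> nat" and v assume "strict_mono r" "\<And>j. c (r j) = v"
    then have "strict_mono r \<and> weakly_p_summable p (\<lambda>j. X (r j) - u v)"
      by (simp add: c weakly_p_summable_0)
    then show ?thesis by blast
  next
    fix r :: "nat \<Rightarrow> nat" assume r: "strict_mono r" "strict_mono (\<lambda>j. c (r j))"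
    have "weakly_p_summable p (\<lambda>j. u (c (r j)))"
      by (rule weakly_p_summable_reindex[OF assms strict_mono_imp_inj_on[OF r(2)]])
    then have "strict_mono r \<and> weakly_p_summable p (\<lambda>j. X (r j) - 0)" using r by (simp add: c)
    then show ?thesis by blast
  qed
qed

lemma weak_star_null_uminus: "weak_star_null f \<Longrightarrow> weak_star_null (\<lambda>n. - f n)"
  unfolding weak_star_null_def blinfun.minus_left using tendsto_minus by fastforce

text \<open>The positive property controls positive weak* null sequences only; on disjoint positive elements
  an arbitrary one is squeezed between two of them.\<close>
lemma positive_DP_star_disjoint_null:
  fixes u :: "nat \<Rightarrow> 'a::banach_lattice" and f :: "nat \<Rightarrow> 'a \<Rightarrow>\<^sub>L real"
  assumes dc: "sigma_dedekind_complete TYPE('a)" and DP: "positive_DP_star TYPE('a) p"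
    and f: "weak_star_null f" and u: "weakly_p_summable p u"
    and u0: "\<And>n. 0 \<le> u n" and disj: "\<And>i k. i \<noteq> k \<Longrightarrow> inf (u i) (u k) = 0"
  shows "(\<lambda>n. blinfun_apply (f n) (u n)) \<longlonglongrightarrow> 0"
proof -
  have lim: "(\<lambda>n. blinfun_apply (g n) (u n)) \<longlonglongrightarrow> 0"
    if "weak_star_null g" "\<forall>n. positive_functional (g n)" for g
  proof (rule uniformly_null_diagonal[of "\<lambda>n. blinfun_apply (g n)" "range u" u])
    have "positively_limited_set (range u)"
      using DP relatively_weakly_p_compact_range[OF u] by (simp add: positive_DP_star_def)
    then show "uniform_limit (range u) (\<lambda>n. blinfun_apply (g n)) (\<lambda>x. 0) sequentially"
      using that by (simp add: positively_limited_set_def)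
  qed simp
  obtain g :: "nat \<Rightarrow> 'a \<Rightarrow>\<^sub>L real" where g: "weak_star_null g" "\<forall>n. positive_functional (g n)"
    "\<And>n. blinfun_apply (f n) (u n) \<le> blinfun_apply (g n) (u n)"
    using positive_weak_star_null_majorant[where u = u, OF dc f u0 disj] by blast
  obtain k :: "nat \<Rightarrow> 'a \<Rightarrow>\<^sub>L real" where k: "weak_star_null k" "\<forall>n. positive_functional (k n)"
    "\<And>n. blinfun_apply (- f n) (u n) \<le> blinfun_apply (k n) (u n)"
    using positive_weak_star_null_majorant[where u = u, OF dc weak_star_null_uminus[OF f] u0 disj] by blast
  have lower: "(\<lambda>n. - blinfun_apply (k n) (u n)) \<longlonglongrightarrow> 0"
    using tendsto_minus[OF lim[OF k(1,2)]] by simp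
  show ?thesis
  proof (rule tendsto_sandwich[OF _ _ lower lim[OF g(1,2)]])
    have "- blinfun_apply (k n) (u n) \<le> blinfun_apply (f n) (u n)" for n
      using k(3)[of n] by (simp add: blinfun.minus_left)
    then show "\<forall>\<^sub>F n in sequentially. - blinfun_apply (k n) (u n) \<le> blinfun_apply (f n) (u n)" by simp
    show "\<forall>\<^sub>F n in sequentially. blinfun_apply (f n) (u n) \<le> blinfun_apply (g n) (u n)" using g(3) by simp
  qed
qed

text \<open>A gap in the uniform convergence on \<open>range x\<close> is witnessed by points \<open>x (c j)\<close>.  If the
  indices \<open>c j\<close> are constant, this contradicts weak* convergence at one point; if they increase,
  positive and negative parts are disjoint minorants of a weakly \<open>p\<close>-summable sequence and are
  covered by the squeezing argument.\<close>
lemma positive_DP_star_imp_disjoint_DP_star: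
  assumes p: "1 \<le> p" and dc: "sigma_dedekind_complete TYPE('a::banach_lattice)"
    and DP: "positive_DP_star TYPE('a) p"
  shows "disjoint_DP_star TYPE('a) p"
  unfolding disjoint_DP_star_def limited_set_def
proof (intro allI impI, rule ccontr)
  fix x :: "nat \<Rightarrow> 'a" and f :: "nat \<Rightarrow> 'a \<Rightarrow>\<^sub>L real"
  assume x: "disjoint_seq x \<and> weakly_p_summable p x" and f: "weak_star_null f"
    and not: "\<not> uniform_limit (range x) (\<lambda>n. blinfun_apply (f n)) (\<lambda>x. 0) sequentially"
  obtain e X and s :: "nat \<Rightarrow> nat" where e: "0 < e" and s: "strict_mono s" and "\<forall>j. X j \<in> range x"
    and fX: "\<And>j. e \<le> \<bar>blinfun_apply (f (s j)) (X j)\<bar>"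
    using not_uniformly_null_subseq[OF not] by blast
  then have "\<forall>j. \<exists>k. X j = x k" by blast
  then obtain c where c: "\<And>j. X j = x (c j)" by metis
  have fs: "weak_star_null (\<lambda>j. f (s (r j)))" if "strict_mono r" for r
    using weak_star_null_subseq[OF weak_star_null_subseq[OF f s] that] .
  have gap: False if lim: "(\<lambda>j. blinfun_apply (f (s (r j))) (x (c (r j)))) \<longlonglongrightarrow> 0" for r
  proof -
    have "\<forall>\<^sub>F j in sequentially. dist (blinfun_apply (f (s (r j))) (x (c (r j)))) 0 < e"
      using lim e by (rule tendstoD)
    then have "\<forall>\<^sub>F j :: nat in sequentially. False"
    proof eventually_elim
      case (elim j)
      then show ?case using fX[of "r j"] by (simp add: c)
    qed
    then show False by simp
  qed
  show False
  proof (rule subseq_const_or_strict_mono[of c])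
    fix r :: "nat \<Rightarrow> nat" and v assume r: "strict_mono r" "\<And>j. c (r j) = v"
    have "(\<lambda>j. blinfun_apply (f (s (r j))) (x v)) \<longlonglongrightarrow> 0"
      using fs[OF r(1)] by (simp add: weak_star_null_def)
    then show False using gap[of r] r(2) by simp
  next
    fix r :: "nat \<Rightarrow> nat" assume r: "strict_mono r" "strict_mono (\<lambda>j. c (r j))"
    define \<xi> where "\<xi> j = x (c (r j))" for j
    have sum: "weakly_p_summable p \<xi>"
      unfolding \<xi>_def by (rule weakly_p_summable_reindex[OF conjunct2[OF x] strict_mono_imp_inj_on[OF r(2)]])
    have disj: "inf \<bar>\<xi> i\<bar> \<bar>\<xi> k\<bar> = 0" if "i \<noteq> k" for i k
    proof -
      have "c (r i) \<noteq> c (r k)" using that strict_mono_eq[OF r(2)] by simp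
      then show ?thesis using x by (simp add: disjoint_seq_def \<xi>_def)
    qed
    have part: "(\<lambda>j. blinfun_apply (f (s (r j))) (u j)) \<longlonglongrightarrow> 0"
      if u: "\<And>j. 0 \<le> u j" "\<And>j. u j \<le> \<bar>\<xi> j\<bar>" for u
    proof -
      have d: "inf (u i) (u k) = 0" if "i \<noteq> k" for i k
        by (rule inf_eq_0_mono[OF disj[OF that] u(1) u(2) u(1) u(2)])
      have "weakly_p_summable p u"
        by (rule weakly_p_summable_disjoint_minorant[OF p sum u(1) d u(2)])
      then show ?thesis by (rule positive_DP_star_disjoint_null[OF dc DP fs[OF r(1)] _ u(1) d])
    qed
    have "(\<lambda>j. blinfun_apply (f (s (r j))) (pprt (\<xi> j)) - blinfun_apply (f (s (r j))) (pprt (- \<xi> j))) \<longlonglongrightarrow> 0 - 0"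
      by (intro tendsto_diff part zero_le_pprt pprt_le_abs pprt_uminus_le_abs)
    then have "(\<lambda>j. blinfun_apply (f (s (r j))) (\<xi> j)) \<longlonglongrightarrow> 0"
      by (simp only: blinfun.diff_right[symmetric] pprt_diff diff_0_right)
    then show False unfolding \<xi>_def by (rule gap)
  qed
qed

theorem corollary3p8:
  fixes p :: real
  assumes "p \<ge> 2"
    and "sigma_dedekind_complete TYPE('a::banach_lattice)"
  shows "positive_DP_star TYPE('a) p \<longleftrightarrow> disjoint_DP_star TYPE('a) p"
proof -
  have "1 \<le> p" using assms(1) by simp
  then show ?thesis
    using positive_DP_star_imp_disjoint_DP_star[OF _ assms(2)] disjoint_DP_star_imp_positive_DP_star
    by blast
qed

end
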